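(* Let $\Omega\subseteq\mathbb{R}^n$ be open and bounded, let $\mathbf{a}=[a_1,\dots,a_n]^T\colon\Omega\to\mathbb{R}^n_+\setminus\{0\}$ and $f\colon\Omega\to\mathbb{R}$ be continuous, and suppose that the square roots $\sqrt{\hat a_i}$ of $$\hat a_i(x):=\frac{a_i(x)}{|\mathbf{a}(x)|_1},\qquad i=1,\dots,n,$$ are locally Lipschitz in $\Omega$. Then the comparison principle holds for the equation $$\sum_{i=1}^n a_i(x)\lambda_i(\mathcal{H}w)=f(x)\qquad\text{in }\Omega.$$
   Context: $\mathbb{R}^n_+=\{z\in\mathbb{R}^n : z_i\ge0 \text{ for all } i\}$ and $|\mathbf{a}(x)|_1=\sum_{i=1}^n|a_i(x)|$. $\mathcal{S}^n$ is the space of real symmetric $n\times n$ matrices; $\lambda_1(X)\le\dots\le\lambda_n(X)$ are the eigenvalues of $X\in\mathcal{S}^n$ in increasing order; $\mathcal{H}w$ is the Hessian matrix of $w$. Write $F(X,x):=\sum_{i=1}^n a_i(x)\lambda_i(X)-f(x)$, so that the equation is $F(\mathcal{H}w,x)=0$. Viscosity solutions: $v\in USC(\overline\Omega)$ is a viscosity subsolution of $F(\mathcal{H}w,x)=0$ in $\Omega$ if, whenever $x_0\in\Omega$ and $\phi$ is a $C^2$ function near $x_0$ with $\phi(x_0)=v(x_0)$ and $\phi\ge v$ near $x_0$, then $F(\mathcal{H}\phi(x_0),x_0)\ge0$. $u\in LSC(\overline\Omega)$ is a viscosity supersolution if, whenever $\phi$ is $C^2$ near $x_0\in\Omega$ with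 $\phi(x_0)=u(x_0)$ and $\phi\le u$ near $x_0$, then $F(\mathcal{H}\phi(x_0),x_0)\le0$. ($USC$, $LSC$: real-valued upper/lower semicontinuous functions.) The comparison principle holds for the equation in $\Omega$ if: whenever $v\in USC(\overline\Omega)$ is a viscosity subsolution and $u\in LSC(\overline\Omega)$ is a viscosity supersolution in $\Omega$ with $v\le u$ on $\partial\Omega$, then $v\le u$ in $\Omega$. *)

theory Defs
  imports "HOL-Analysis.Analysis" "HOL-Computational_Algebra.Polynomial"
begin

definition charpoly :: "real^'n^'n \<Rightarrow> real poly" where
  "charpoly X = det (\<chi> i j. if i = j then [:- (X $ i $ j), 1:] else [:- (X $ i $ j):])"

(* The real eigenvalues, repeated according to algebraic multiplicity, in increasing order.
   For symmetric X the list has length CARD('n). Indices start at 1; eigval i X is unspecified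
   for i outside {1..CARD('n)}. *)
definition eigvals :: "real^'n^'n \<Rightarrow> real list" where
  "eigvals X = sorted_list_of_multiset (proots (charpoly X))"

definition eigval :: "nat \<Rightarrow> real^'n^'n \<Rightarrow> real" where
  "eigval i X = eigvals X ! (i - 1)"

definition grad :: "(real^'n \<Rightarrow> real) \<Rightarrow> real^'n \<Rightarrow> real^'n" where
  "grad \<phi> x = (\<chi> i. frechet_derivative \<phi> (at x) (axis i 1))"

definition hessian :: "(real^'n \<Rightarrow> real) \<Rightarrow> real^'n \<Rightarrow> real^'n^'n" where
  "hessian \<phi> x = jacobian (grad \<phi>) (at x)"

definition C2_near :: "(real^'n \<Rightarrow> real) \<Rightarrow> real^'n \<Rightarrow> bool" where
  "C2_near \<phi> x0 \<longleftrightarrow>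
     (\<exists>U. open U \<and> x0 \<in> U \<and>
          (\<forall>x\<in>U. \<phi> differentiable (at x)) \<and>
          (\<forall>x\<in>U. grad \<phi> differentiable (at x)) \<and>
          continuous_on U (hessian \<phi>))"

definition usc_on :: "'a::topological_space set \<Rightarrow> ('a \<Rightarrow> real) \<Rightarrow> bool" where
  "usc_on S v \<longleftrightarrow> (\<forall>x\<in>S. \<forall>c. v x < c \<longrightarrow> (\<forall>\<^sub>F y in at x within S. v y < c))"

definition lsc_on :: "'a::topological_space set \<Rightarrow> ('a \<Rightarrow> real) \<Rightarrow> bool" where
  "lsc_on S u \<longleftrightarrow> (\<forall>x\<in>S. \<forall>c. c < u x \<longrightarrow> (\<forall>\<^sub>F y in at x within S. c < u y))"

(* An equation F(Hw, x) = 0 is represented by the function F. Functions on the closure of Om are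
   represented by total functions: since Om is open in all uses, their values outside the closure
   are irrelevant below. *)
definition viscosity_subsolution ::
    "(real^'n^'n \<Rightarrow> real^'n \<Rightarrow> real) \<Rightarrow> (real^'n) set \<Rightarrow> (real^'n \<Rightarrow> real) \<Rightarrow> bool" where
  "viscosity_subsolution F Om v \<longleftrightarrow>
     usc_on (closure Om) v \<and>
     (\<forall>x0\<in>Om. \<forall>\<phi>. C2_near \<phi> x0 \<and> \<phi> x0 = v x0 \<and> (\<forall>\<^sub>F x in nhds x0. v x \<le> \<phi> x)
        \<longrightarrow> 0 \<le> F (hessian \<phi> x0) x0)"

definition viscosity_supersolution ::
    "(real^'n^'n \<Rightarrow> real^'n \<Rightarrow> real) \<Rightarrow> (real^'n) set \<Rightarrow> (real^'n \<Rightarrow> real) \<Rightarrow> bool" where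
  "viscosity_supersolution F Om u \<longleftrightarrow>
     lsc_on (closure Om) u \<and>
     (\<forall>x0\<in>Om. \<forall>\<phi>. C2_near \<phi> x0 \<and> \<phi> x0 = u x0 \<and> (\<forall>\<^sub>F x in nhds x0. \<phi> x \<le> u x)
        \<longrightarrow> F (hessian \<phi> x0) x0 \<le> 0)"

definition comparison_principle ::
    "(real^'n^'n \<Rightarrow> real^'n \<Rightarrow> real) \<Rightarrow> (real^'n) set \<Rightarrow> bool" where
  "comparison_principle F Om \<longleftrightarrow>
     (\<forall>v u. viscosity_subsolution F Om v \<longrightarrow> viscosity_supersolution F Om u \<longrightarrow>
        (\<forall>x\<in>frontier Om. v x \<le> u x) \<longrightarrow> (\<forall>x\<in>Om. v x \<le> u x))"

definition locally_lipschitz_on ::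
    "'a::metric_space set \<Rightarrow> ('a \<Rightarrow> 'b::metric_space) \<Rightarrow> bool" where
  "locally_lipschitz_on S g \<longleftrightarrow> (\<forall>x\<in>S. \<exists>r>0. \<exists>L. L-lipschitz_on (ball x r \<inter> S) g)"

(* Coefficient vectors are families a 1, ..., a n with n = CARD('n), indexed by nat because the
   index refers to the position of an eigenvalue in increasing order. *)
definition ahat :: "(nat \<Rightarrow> real^'n \<Rightarrow> real) \<Rightarrow> nat \<Rightarrow> real^'n \<Rightarrow> real" where
  "ahat a i x = a i x / (\<Sum>j=1..CARD('n). \<bar>a j x\<bar>)"

end

theory Submission
  imports Defs "HOL-Complex_Analysis.Great_Picard"
begin

text \<open>Replace the subsolution \<open>v\<close> by the strict subsolution \<open>v + \<theta> |x|\<^sup>2 / 2\<close>, divide the equation by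
  \<open>|a|\<^sub>1\<close>, and double the variables with penalty \<open>\<alpha> |x - y|\<^sup>2 / 2\<close>. The theorem on sums gives Hessians
  \<open>X\<close>, \<open>Y\<close> with \<open>X \<xi> \<bullet> \<xi> - Y \<zeta> \<bullet> \<zeta> \<le> \<alpha> |\<xi> - \<zeta>|\<^sup>2\<close>, up to a small error. Testing with multiples of one
  vector gives \<open>s\<^sup>2 X \<le> t\<^sup>2 Y + \<alpha> (s - t)\<^sup>2\<close> for all \<open>s\<close>, \<open>t\<close>, hence the same inequality for each
  eigenvalue. With \<open>s\<close>, \<open>t\<close> the square roots of the normalised weights at the two points the error is
  \<open>O(\<alpha> |x - y|\<^sup>2)\<close>, which tends to 0.

  The theorem on sums is obtained without Alexandrov's theorem. Since the equation does not involve the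
  gradient, it suffices that the sup-convolutions lie below a quadratic polynomial at one small scale around
  one contact point. They are replaced by their hulls by paraboloids, which have Lipschitz gradients; the
  contact points form a set of positive measure (Jensen), and a Lipschitz map is nearly affine at arbitrarily
  small scales around almost every point.\<close>

section \<open>Eigenvalues of symmetric matrices\<close>

text \<open>Some weights may vanish and they need not be monotone in the index, so the operator is
  degenerate elliptic but in general neither convex nor concave; the two Hessians have to be
  compared eigenvalue by eigenvalue. After division by |a|_1 the weights sum to 1, so shifting the
  Hessian by \<theta> times the identity moves the normalised operator by exactly \<theta>. No lower
  bound on |a|_1 near the boundary is needed, only continuity of f / |a|_1 at an interior limit
  point. Square roots enter because their difference occurs squared: a Lipschitz bound makes the
  error comparable to the penalty. Lipschitz weights alone would give only a multiple of \<alpha> |x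
  - y|, which need not tend to 0. A linear part of the gradient at a single scale is weaker than a
  second derivative, since it may change with the scale. It suffices because the block inequality is
  homogeneous of degree two: it can be read off on one ball, with an error proportional to the
  squared radius. The price is that the touching points move inside that ball, so they maximise the
  doubled function only approximately.\<close>

lemma symmetric_matrix_inner:
  fixes X :: "real^'n^'n"
  assumes "transpose X = X"
  shows "(X *v u) \<bullet> v = u \<bullet> (X *v v)"
  by (metis assms dot_lmul_matrix inner_commute vector_transpose_matrix)

text \<open>The maximum of the quadratic form over the unit sphere of an invariant subspace is an eigenvalue.\<close>

lemma eigenvector_in_invariant_subspace:
  fixes X :: "real^'n^'n"
  assumes sym: "transpose X = X" and S: "subspace S" "S \<noteq> {0}"
    and inv: "\<And>x. x \<in> S \<Longrightarrow> X *v x \<in> S"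
  obtains e \<mu> where "e \<in> S" "norm e = 1" "X *v e = \<mu> *\<^sub>R e"
proof -
  let ?K = "S \<inter> sphere 0 1"
  obtain s where s: "s \<in> S" "s \<noteq> 0" using S subspace_0 by blast
  have "compact ?K" using closed_subspace[OF S(1)] by (simp add: closed_Int_compact)
  moreover have "?K \<noteq> {}"
    using s subspace_scale[OF S(1) s(1), of "1 / norm s"] by (auto intro!: exI[of _ "(1 / norm s) *\<^sub>R s"])
  moreover have "continuous_on ?K (\<lambda>x. (X *v x) \<bullet> x)"
    by (intro continuous_intros matrix_vector_mult_linear_continuous_on)
  ultimately obtain e where e: "e \<in> ?K" and max: "\<And>x. x \<in> ?K \<Longrightarrow> (X *v x) \<bullet> x \<le> (X *v e) \<bullet> e"
    using continuous_attains_sup[of ?K "\<lambda>x. (X *v x) \<bullet> x"] by blast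
  define \<mu> where "\<mu> = (X *v e) \<bullet> e"
  have e1: "norm e = 1" "e \<in> S" "e \<bullet> e = 1" using e by (auto simp: dot_square_norm)
  have form: "(X *v x) \<bullet> x \<le> \<mu> * (norm x)\<^sup>2" if "x \<in> S" for x
  proof (cases "x = 0")
    case False
    have "(1 / norm x) *\<^sub>R x \<in> ?K" using that False S(1) by (simp add: subspace_scale)
    from max[OF this] show ?thesis
      using False by (simp add: \<mu>_def matrix_vector_mult_scaleR power2_eq_square field_simps)
  qed simp
  define r where "r = X *v e - \<mu> *\<^sub>R e"
  have r: "r \<in> S" using inv e1 S(1) by (auto simp: r_def intro: subspace_diff subspace_scale)
  have re: "r \<bullet> e = 0" by (simp add: r_def \<mu>_def inner_diff_left e1)
  have Xer: "(X *v e) \<bullet> r = r \<bullet> r"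
    using re by (simp add: r_def inner_simps inner_commute)
  \<comment> \<open>Comparing the form at \<open>e\<close> and at \<open>e + t *\<^sub>R r\<close>
    leaves a gain linear in \<open>t\<close> bounded by a term quadratic in \<open>t\<close>. Small
    positive \<open>t\<close> then forces the residual \<open>r\<close> to vanish.\<close>
  have quad: "2 * t * (r \<bullet> r) \<le> t\<^sup>2 * (\<mu> * (r \<bullet> r) - (X *v r) \<bullet> r)" for t
  proof -
    have "e + t *\<^sub>R r \<in> S" using r e1 S(1) by (simp add: subspace_add subspace_scale)
    from form[OF this]
    have "(X *v (e + t *\<^sub>R r)) \<bullet> (e + t *\<^sub>R r) \<le> \<mu> * ((e + t *\<^sub>R r) \<bullet> (e + t *\<^sub>R r))"
      by (simp add: power2_norm_eq_inner)
    moreover have "(X *v r) \<bullet> e = r \<bullet> r"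
      using symmetric_matrix_inner[OF sym, of r e] Xer by (simp add: inner_commute)
    moreover have "e \<bullet> (X *v e) = \<mu>" by (simp add: \<mu>_def inner_commute)
    ultimately show ?thesis
      using re Xer e1 
      by (simp add: matrix_vector_right_distrib matrix_vector_mult_scaleR inner_simps inner_commute
          \<mu>_def[symmetric] power2_eq_square algebra_simps)
  qed
  have "r \<bullet> r = 0"
  proof (rule ccontr)
    assume "r \<bullet> r \<noteq> 0"
    then have rr: "r \<bullet> r > 0" by simp
    define c where "c = \<bar>\<mu> * (r \<bullet> r) - (X *v r) \<bullet> r\<bar> + 1"
    have c: "c > 0" "\<mu> * (r \<bullet> r) - (X *v r) \<bullet> r < c" by (auto simp: c_def)
    define t where "t = (r \<bullet> r) / c"
    have t: "t > 0" "t * c = r \<bullet> r" using rr c by (auto simp: t_def)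
    have "2 * t * (r \<bullet> r) \<le> t\<^sup>2 * c"
      using quad[of t] c(2) by (smt (verit) mult_left_mono zero_le_power2)
    also have "\<dots> = t * (r \<bullet> r)" using t(2) by (simp add: power2_eq_square)
    finally show False using t rr by (simp add: mult_le_cancel_right)
  qed
  then have "X *v e = \<mu> *\<^sub>R e" by (simp add: r_def)
  with e1 show thesis by (intro that)
qed

text \<open>Induction on the dimension: once an eigenvector \<open>e\<close> is split off, symmetry
  of \<open>X\<close> keeps the orthogonal complement \<open>T\<close> of \<open>e\<close> in
  \<open>S\<close> invariant.\<close>

lemma orthonormal_eigenbasis_subspace:
  fixes X :: "real^'n^'n"
  assumes sym: "transpose X = X" and "subspace S" and "\<And>x. x \<in> S \<Longrightarrow> X *v x \<in> S"
  shows "\<exists>B. B \<subseteq> S \<and> card B = dim S \<and> finite B \<and> pairwise orthogonal B \<and> (\<forall>b\<in>B. norm b = 1 \<and> (\<exists>\<mu>. X *v b = \<mu> *\<^sub>R b))"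
  using assms(2,3)
proof (induction "dim S" arbitrary: S)
  case 0
  then show ?case by (intro exI[of _ "{}"]) auto
next
  case (Suc d)
  then have "S \<noteq> {0}" by auto
  then obtain e \<mu> where e: "e \<in> S" "norm e = 1" "X *v e = \<mu> *\<^sub>R e"
    using eigenvector_in_invariant_subspace[OF sym Suc.prems(1)] Suc.prems(2) by metis
  have ee: "e \<bullet> e = 1" using e(2) by (simp add: dot_square_norm)
  define T where "T = {x \<in> S. x \<bullet> e = 0}"
  have T: "subspace T"
    using Suc.prems(1) by (auto simp: T_def subspace_def inner_simps)
  have S_eq: "S = span (insert e T)"
  proof
    show "S \<subseteq> span (insert e T)"
    proof
      fix x assume "x \<in> S"
      then have "x - (x \<bullet> e) *\<^sub>R e \<in> T"
        using e(1) Suc.prems(1) ee by (auto simp: T_def inner_simps subspace_diff subspace_scale)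
      then show "x \<in> span (insert e T)"
        unfolding span_insert using span_base by blast
    qed
    show "span (insert e T) \<subseteq> S"
      using e(1) Suc.prems(1) by (intro span_minimal) (auto simp: T_def)
  qed
  have "e \<notin> T" using ee by (simp add: T_def)
  then have "e \<notin> span T" using T span_eq_iff by blast
  then have "dim S = Suc (dim T)"
    using S_eq dim_insert[of e T] by simp
  then have "d = dim T" using Suc.hyps(2) by simp
  moreover have "X *v x \<in> T" if "x \<in> T" for x
    using that Suc.prems(2) symmetric_matrix_inner[OF sym, of x e] by (auto simp: T_def e(3))
  ultimately obtain B where B: "B \<subseteq> T" "card B = dim T" "finite B" "pairwise orthogonal B"
     "\<forall>b\<in>B. norm b = 1 \<and> (\<exists>\<mu>. X *v b = \<mu> *\<^sub>R b)"
    using Suc.hyps(1)[OF _ T] by blast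
  have "e \<notin> B" using B(1) \<open>e \<notin> T\<close> by blast
  then show ?case
    using B e \<open>dim S = Suc (dim T)\<close>
    by (intro exI[of _ "insert e B"])
      (auto simp: T_def pairwise_insert orthogonal_def inner_commute)
qed

lemma orthonormal_eigenbasis:
  fixes X :: "real^'n^'n"
  assumes sym: "transpose X = X"
  obtains e :: "'n \<Rightarrow> real^'n" and \<mu> where
    "\<And>i j. e i \<bullet> e j = (if i = j then 1 else 0)" "\<And>i. X *v e i = \<mu> i *\<^sub>R e i"
proof -
  obtain B where B: "card B = CARD('n)" "finite B" "pairwise orthogonal B"
     "\<forall>b\<in>B. norm b = 1 \<and> (\<exists>\<mu>. X *v b = \<mu> *\<^sub>R b)"
    using orthonormal_eigenbasis_subspace[OF sym subspace_UNIV] by auto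
  obtain e where e: "bij_betw e (UNIV :: 'n set) B"
    using B(1,2) finite_same_card_bij[of "UNIV :: 'n set" B] by auto
  have eB: "e i \<in> B" for i using e by (auto simp: bij_betw_def)
  have "e i \<bullet> e j = (if i = j then 1 else 0)" for i j
  proof (cases "i = j")
    case True
    then show ?thesis using B(4) eB[of i] by (simp add: dot_square_norm)
  next
    case False
    then have "e i \<noteq> e j" using e by (auto simp: bij_betw_def inj_on_def)
    then show ?thesis using B(3) eB False by (auto simp: pairwise_def orthogonal_def)
  qed
  moreover have "\<forall>i. \<exists>\<mu>. X *v e i = \<mu> *\<^sub>R e i" using B(4) eB by blast
  then obtain \<mu> where "\<And>i. X *v e i = \<mu> i *\<^sub>R e i" by metis
  ultimately show thesis by (rule that)
qed

section \<open>Roots of the characteristic polynomial and sorted eigenvalues\<close>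

lemma poly_charpoly: "poly (charpoly X) x = det (mat x - X)"
proof -
  have "poly (if i = j then [:- (X $ i $ j), 1:] else [:- (X $ i $ j):]) x = (mat x - X) $ i $ j" for i j
    by (simp add: mat_def)
  then show ?thesis
    by (simp add: charpoly_def det_def poly_sum poly_prod)
qed

text \<open>The rows of \<open>P\<close> are the eigenvectors, so conjugation by \<open>P\<close>
  makes \<open>mat x - X\<close> diagonal for each real \<open>x\<close>, and polynomials that agree
  at every real point are equal.\<close>

lemma charpoly_eq_prod:
  fixes X :: "real^'n^'n" and e :: "'n \<Rightarrow> real^'n"
  assumes e: "\<And>i j. e i \<bullet> e j = (if i = j then 1 else 0)" "\<And>i. X *v e i = \<mu> i *\<^sub>R e i"
  shows "charpoly X = (\<Prod>i\<in>UNIV. [:- \<mu> i, 1:])"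
proof (rule poly_eq_poly_eq_iff[THEN iffD1], rule ext)
  fix x
  define P :: "real^'n^'n" where "P = (\<chi> i. e i)"
  define D :: "real^'n^'n" where "D = (\<chi> i j. if i = j then x - \<mu> i else 0)"
  have P: "P ** transpose P = mat 1"
    using e(1) by (simp add: P_def matrix_matrix_mult_def transpose_def mat_def vec_eq_iff inner_vec_def)
  have "P ** (mat x - X) ** transpose P = D"
  proof -
    have "(P ** ((mat x - X) ** transpose P)) $ i $ j = D $ i $ j" for i j
    proof -
      have "((mat x - X) ** transpose P) $ k $ j = ((mat x - X) *v e j) $ k" for k
        by (simp add: P_def matrix_matrix_mult_def transpose_def matrix_vector_mult_def)
      moreover have "(mat x - X) *v e j = (x - \<mu> j) *\<^sub>R e j"
      proof -
        have "mat x *v e j = x *\<^sub>R e j"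
          by (simp add: mat_def matrix_vector_mult_def vec_eq_iff if_distrib[of "\<lambda>a. a * _"] cong: if_cong)
        then show ?thesis
          by (simp add: matrix_vector_mult_diff_rdistrib e(2) scaleR_diff_left)
      qed
      ultimately have "(P ** ((mat x - X) ** transpose P)) $ i $ j = e i \<bullet> ((x - \<mu> j) *\<^sub>R e j)"
        by (simp add: P_def matrix_matrix_mult_def inner_vec_def)
      then show ?thesis using e(1) by (simp add: D_def)
    qed
    then show ?thesis by (simp add: matrix_mul_assoc vec_eq_iff)
  qed
  then have "det P * det (mat x - X) * det (transpose P) = det D"
    by (metis det_mul)
  moreover have "det P * det (transpose P) = 1"
    using P by (metis det_I det_mul)
  moreover have "det D = (\<Prod>i\<in>UNIV. x - \<mu> i)"
    by (subst det_diagonal) (auto simp: D_def)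
  ultimately have "det (mat x - X) = (\<Prod>i\<in>UNIV. x - \<mu> i)"
    by (metis mult.assoc mult.commute mult_1)
  then show "poly (charpoly X) x = poly (\<Prod>i\<in>UNIV. [:- \<mu> i, 1:]) x"
    by (simp add: poly_charpoly poly_prod)
qed

text \<open>The bridge from the list of roots in \<open>eigvals\<close> to eigenvectors: sorting the
  indices by eigenvalue puts each eigenvector at the position of its root, with multiplicity.
  Positions start at 0 here, at 1 in \<open>eigval\<close>.\<close>

lemma eigvals_orthonormal_eigenbasis:
  fixes X :: "real^'n^'n"
  assumes sym: "transpose X = X"
  obtains e :: "nat \<Rightarrow> real^'n" where
    "\<And>i j. i < CARD('n) \<Longrightarrow> j < CARD('n) \<Longrightarrow> e i \<bullet> e j = (if i = j then 1 else 0)"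
    "\<And>i. i < CARD('n) \<Longrightarrow> X *v e i = (eigvals X ! i) *\<^sub>R e i"
    "\<And>i j. i \<le> j \<Longrightarrow> j < CARD('n) \<Longrightarrow> eigvals X ! i \<le> eigvals X ! j"
proof -
  obtain e :: "'n \<Rightarrow> real^'n" and \<mu> where e:
    "\<And>i j. e i \<bullet> e j = (if i = j then 1 else 0)" "\<And>i. X *v e i = \<mu> i *\<^sub>R e i"
    using orthonormal_eigenbasis[OF sym] by blast
  obtain xs :: "'n list" where xs: "set xs = UNIV" "distinct xs"
    using finite_distinct_list[of "UNIV :: 'n set"] by auto
  define ys where "ys = sort_key \<mu> xs"
  have ys: "distinct ys" "length ys = CARD('n)" "sorted (map \<mu> ys)"
    using xs distinct_card[of xs] by (auto simp: ys_def)
  have "proots (charpoly X) = (\<Sum>i\<in>UNIV. {#\<mu> i#})"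
    by (simp add: charpoly_eq_prod[OF e] proots_prod)
  also have "\<dots> = image_mset \<mu> (mset_set UNIV)"
    by (simp add: sum_unfold_sum_mset)
  also have "\<dots> = mset (map \<mu> ys)"
    using xs by (simp add: ys_def flip: mset_set_set)
  finally have "eigvals X = map \<mu> ys"
    using ys(3) by (simp add: eigvals_def sorted_list_of_multiset_mset sorted_sort_id del: mset_map)
  with ys show thesis
    using e by (intro that[of "\<lambda>i. e (ys ! i)"])
      (auto simp: nth_eq_iff_index_eq sorted_iff_nth_mono simp del: nth_map simp flip: nth_map[of _ ys \<mu>])
qed

section \<open>Comparing eigenvalues through quadratic forms\<close>

lemma quadratic_form_eigenspan:
  fixes X :: "real^'n^'n"
  assumes I: "finite I" and on: "\<And>i j. i \<in> I \<Longrightarrow> j \<in> I \<Longrightarrow> e i \<bullet> e j = (if i = j then 1 else (0::real))"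
    and eig: "\<And>i. i \<in> I \<Longrightarrow> X *v e i = \<mu> i *\<^sub>R e i" and \<xi>: "\<xi> \<in> span (e ` I)"
  obtains a where "(X *v \<xi>) \<bullet> \<xi> = (\<Sum>i\<in>I. \<mu> i * (a i)\<^sup>2)" "(norm \<xi>)\<^sup>2 = (\<Sum>i\<in>I. (a i)\<^sup>2)"
proof -
  have inj: "inj_on e I" using on by (intro inj_onI) (metis zero_neq_one)
  obtain u where "\<xi> = (\<Sum>v\<in>e ` I. u v *\<^sub>R v)"
    using \<xi> span_finite[of "e ` I"] I by auto
  then obtain a where a: "\<xi> = (\<Sum>i\<in>I. a i *\<^sub>R e i)"
    by (intro that[of "\<lambda>i. u (e i)"]) (simp add: sum.reindex[OF inj])
  have ip: "(\<Sum>i\<in>I. b i *\<^sub>R e i) \<bullet> \<xi> = (\<Sum>i\<in>I. b i * a i)" for b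
  proof -
    have "(\<Sum>i\<in>I. b i *\<^sub>R e i) \<bullet> \<xi> = (\<Sum>i\<in>I. b i * (\<Sum>j\<in>I. a j * (e i \<bullet> e j)))"
      unfolding inner_sum_left by (simp add: a inner_sum_right sum_distrib_left mult_ac)
    also have "\<dots> = (\<Sum>i\<in>I. b i * (\<Sum>j\<in>I. if i = j then a j else 0))"
      using on by (intro sum.cong arg_cong2[where f="(*)"] refl) auto
    finally show ?thesis using I by simp
  qed
  have "X *v \<xi> = (\<Sum>i\<in>I. (a i * \<mu> i) *\<^sub>R e i)"
    unfolding a linear_sum[OF matrix_vector_mul_linear]
    by (intro sum.cong) (auto simp: matrix_vector_mult_scaleR eig)
  then have "(X *v \<xi>) \<bullet> \<xi> = (\<Sum>i\<in>I. \<mu> i * (a i)\<^sup>2)"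
    using ip[of "\<lambda>i. a i * \<mu> i"] by (simp add: power2_eq_square mult_ac)
  moreover have "(norm \<xi>)\<^sup>2 = (\<Sum>i\<in>I. (a i)\<^sup>2)"
    unfolding power2_norm_eq_inner using ip[of a] by (simp add: power2_eq_square flip: a)
  ultimately show thesis by (rule that)
qed

lemma dim_span_orthonormal:
  fixes e :: "nat \<Rightarrow> 'a::euclidean_space"
  assumes I: "finite I" and on: "\<And>i j. i \<in> I \<Longrightarrow> j \<in> I \<Longrightarrow> e i \<bullet> e j = (if i = j then 1 else (0::real))"
  shows "dim (span (e ` I)) = card I"
proof -
  have inj: "inj_on e I" using on by (intro inj_onI) (metis zero_neq_one)
  have "0 \<notin> e ` I" using on by (metis imageE inner_zero_left zero_neq_one)
  moreover have "pairwise orthogonal (e ` I)"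
    using on by (auto simp: pairwise_def orthogonal_def)
  ultimately have "independent (e ` I)" by (intro pairwise_orthogonal_independent)
  then show ?thesis using inj by (simp add: dim_span dim_eq_card_independent card_image)
qed

text \<open>The dimension count of Courant and Fischer: the span of the upper eigenvectors of
  \<open>X\<close> and that of the lower eigenvectors of \<open>Y\<close> have dimensions adding up
  to \<open>CARD('n) + 1\<close>, so they share a vector \<open>\<xi> \<noteq> 0\<close>. On it one
  form is bounded below and the other above by the eigenvalues at position \<open>m\<close>. The
  factors stay outside the matrices so that they may be zero.\<close>

lemma eigval_le_eigval:
  fixes X Y :: "real^'n^'n"
  assumes X: "transpose X = X" and Y: "transpose Y = Y" and s: "s \<ge> 0" and t: "t \<ge> 0"
    and le: "\<And>\<xi>. s * ((X *v \<xi>) \<bullet> \<xi>) \<le> t * ((Y *v \<xi>) \<bullet> \<xi>) + c * (norm \<xi>)\<^sup>2"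
    and i: "i \<in> {1..CARD('n)}"
  shows "s * eigval i X \<le> t * eigval i Y + c"
proof -
  define m where "m = i - 1"
  have m: "m < CARD('n)" using i by (auto simp: m_def)
  let ?x = "\<lambda>i. eigvals X ! i" and ?y = "\<lambda>i. eigvals Y ! i"
  obtain e :: "nat \<Rightarrow> real^'n" where e:
    "\<And>i j. i < CARD('n) \<Longrightarrow> j < CARD('n) \<Longrightarrow> e i \<bullet> e j = (if i = j then 1 else 0)"
    "\<And>i. i < CARD('n) \<Longrightarrow> X *v e i = ?x i *\<^sub>R e i"
    "\<And>i j. i \<le> j \<Longrightarrow> j < CARD('n) \<Longrightarrow> ?x i \<le> ?x j"
    using eigvals_orthonormal_eigenbasis[OF X] by blast
  obtain g :: "nat \<Rightarrow> real^'n" where g: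
    "\<And>i j. i < CARD('n) \<Longrightarrow> j < CARD('n) \<Longrightarrow> g i \<bullet> g j = (if i = j then 1 else 0)"
    "\<And>i. i < CARD('n) \<Longrightarrow> Y *v g i = ?y i *\<^sub>R g i"
    "\<And>i j. i \<le> j \<Longrightarrow> j < CARD('n) \<Longrightarrow> ?y i \<le> ?y j"
    using eigvals_orthonormal_eigenbasis[OF Y] by blast
  let ?S = "span (e ` {m..<CARD('n)})" and ?T = "span (g ` {..m})"
  have "dim ?S = CARD('n) - m" by (subst dim_span_orthonormal) (auto simp: e(1))
  moreover have "dim ?T = Suc m" using m by (subst dim_span_orthonormal) (auto simp: g(1))
  moreover have "dim {x + y |x y. x \<in> ?S \<and> y \<in> ?T} \<le> CARD('n)"
    using dim_subset_UNIV[of "{x + y |x y. x \<in> ?S \<and> y \<in> ?T}"] by simp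
  ultimately have "dim (?S \<inter> ?T) \<noteq> 0"
    using dim_sums_Int[OF subspace_span subspace_span, of "e ` {m..<CARD('n)}" "g ` {..m}"] m by linarith
  then obtain \<xi> where \<xi>: "\<xi> \<in> ?S" "\<xi> \<in> ?T" "\<xi> \<noteq> 0" by auto
  obtain a where a: "(X *v \<xi>) \<bullet> \<xi> = (\<Sum>i\<in>{m..<CARD('n)}. ?x i * (a i)\<^sup>2)" "(norm \<xi>)\<^sup>2 = (\<Sum>i\<in>{m..<CARD('n)}. (a i)\<^sup>2)"
    by (rule quadratic_form_eigenspan[OF _ _ _ \<xi>(1), of X ?x]) (auto simp: e)
  have "?x m * (norm \<xi>)\<^sup>2 \<le> (X *v \<xi>) \<bullet> \<xi>"
    unfolding a sum_distrib_left using e(3) by (intro sum_mono mult_right_mono) auto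
  moreover obtain b where b: "(Y *v \<xi>) \<bullet> \<xi> = (\<Sum>i\<in>{..m}. ?y i * (b i)\<^sup>2)" "(norm \<xi>)\<^sup>2 = (\<Sum>i\<in>{..m}. (b i)\<^sup>2)"
    using m by (elim quadratic_form_eigenspan[OF _ _ _ \<xi>(2), of Y ?y, rotated -1]) (auto simp: g)
  have "(Y *v \<xi>) \<bullet> \<xi> \<le> ?y m * (norm \<xi>)\<^sup>2"
    unfolding b sum_distrib_left using g(3) m by (intro sum_mono mult_right_mono) auto
  ultimately have "s * (?x m * (norm \<xi>)\<^sup>2) \<le> t * (?y m * (norm \<xi>)\<^sup>2) + c * (norm \<xi>)\<^sup>2"
    using le[of \<xi>] s t by (smt (verit) mult_left_mono)
  then have "(s * ?x m) * (norm \<xi>)\<^sup>2 \<le> (t * ?y m + c) * (norm \<xi>)\<^sup>2"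
    by (simp add: algebra_simps)
  then show ?thesis using \<xi>(3) by (simp add: eigval_def m_def)
qed

section \<open>Paraboloids as test functions\<close>

lemma grad_eqI:
  fixes \<phi> :: "real^'n \<Rightarrow> real"
  assumes "(\<phi> has_derivative (\<lambda>h. g \<bullet> h)) (at x)"
  shows "grad \<phi> x = g"
  using frechet_derivative_at[OF assms, symmetric]
  by (simp add: grad_def vec_eq_iff inner_axis)

text \<open>Quadratic polynomials are the only test functions that the comparison argument feeds
  into the definition of viscosity solutions.\<close>

lemma
  fixes X :: "real^'n^'n" and p x0 :: "real^'n" and c :: real
  assumes sym: "transpose X = X"
  defines "\<phi> \<equiv> \<lambda>x. c + p \<bullet> (x - x0) + (X *v (x - x0)) \<bullet> (x - x0) / 2"
  shows hessian_quadratic: "hessian \<phi> x = X" and C2_near_quadratic: "C2_near \<phi> x"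
proof -
  have sym': "(X *v u) \<bullet> v = u \<bullet> (X *v v)" for u v
    by (rule symmetric_matrix_inner[OF sym])
  have d0: "((\<lambda>x. x - x0) has_derivative (\<lambda>h. h)) (at x)" for x
    by (auto intro!: derivative_eq_intros)
  have d1: "((\<lambda>x. X *v (x - x0)) has_derivative (\<lambda>h. X *v h)) (at x)" for x
    by (rule bounded_linear.has_derivative[OF matrix_vector_mul_bounded_linear d0])
  have der: "(\<phi> has_derivative (\<lambda>h. (p + X *v (x - x0)) \<bullet> h)) (at x)" for x
  proof -
    have "(\<phi> has_derivative (\<lambda>h. 0 + p \<bullet> h + ((X *v (x - x0)) \<bullet> h + (X *v h) \<bullet> (x - x0)) / 2)) (at x)"
      unfolding \<phi>_def divide_inverse
      by (intro has_derivative_add has_derivative_const has_derivative_mult_left has_derivative_inner_right has_derivative_inner[OF d1 d0] d0)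
    moreover have "(X *v h) \<bullet> (x - x0) = (X *v (x - x0)) \<bullet> h" for h
      by (simp add: sym'[of h] inner_commute)
    ultimately show ?thesis by (simp add: inner_add_left)
  qed
  then have grad: "grad \<phi> = (\<lambda>x. p + X *v (x - x0))"
    by (intro ext grad_eqI)
  have der2: "(grad \<phi> has_derivative (\<lambda>h. X *v h)) (at x)" for x
    unfolding grad using has_derivative_add[OF has_derivative_const d1] by simp
  show hess: "hessian \<phi> x = X" for x
    using frechet_derivative_at[OF der2[of x], symmetric]
    by (simp add: hessian_def jacobian_def matrix_of_matrix_vector_mul)
  show "C2_near \<phi> x"
    unfolding C2_near_def using der der2
    by (intro exI[of _ UNIV]) (auto simp: differentiable_def hess)
qed

section \<open>Lipschitz maps at small scales\<close>

lemma nn_integral_lborel_shift: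
  fixes g :: "'a::euclidean_space \<Rightarrow> ennreal"
  assumes "g \<in> borel_measurable borel"
  shows "(\<integral>\<^sup>+x. g (x + v) \<partial>lborel) = (\<integral>\<^sup>+x. g x \<partial>lborel)"
proof -
  have "(\<integral>\<^sup>+x. g x \<partial>lborel) = (\<integral>\<^sup>+x. g x \<partial>distr lborel borel ((+) v))"
    by (simp add: lborel_distr_plus)
  also have "\<dots> = (\<integral>\<^sup>+x. g (v + x) \<partial>lborel)"
    using assms by (subst nn_integral_distr) auto
  finally show ?thesis by (simp add: add.commute)
qed

text \<open>By the parallelogram law the energy of the difference quotients of step \<open>t k\<close> grows with \<open>k\<close>
  by at least the energy of the second differences, and it is bounded since \<open>f\<close> is Lipschitz. The radii
  \<open>r k\<close> increase just enough to absorb the shift by \<open>t (Suc k) d\<close>.\<close>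

lemma dyadic_energy_summable:
  fixes f :: "'a::euclidean_space \<Rightarrow> 'b::euclidean_space" and d :: 'a and R :: real
  assumes lip: "L-lipschitz_on UNIV f"
  defines "t \<equiv> \<lambda>k::nat. (1/2)^k :: real"
  defines "D \<equiv> \<lambda>k x. ennreal ((norm (f (x + (2 * t k) *\<^sub>R d) - 2 *\<^sub>R f (x + t k *\<^sub>R d) + f x) / (2 * t k))\<^sup>2)"
  shows "(\<Sum>k. \<integral>\<^sup>+x. D (Suc k) x * indicator (cball 0 R) x \<partial>lborel) < \<infinity>"
proof -
  define q where "q k x = ennreal ((norm (f (x + t k *\<^sub>R d) - f x) / t k)\<^sup>2)" for k x
  define r where "r k = R + norm d * (1 - t k)" for k
  define I where "I k = (\<integral>\<^sup>+x. q k x * indicator (cball 0 (r k)) x \<partial>lborel)" for k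
  define J where "J k = (\<integral>\<^sup>+x. D (Suc k) x * indicator (cball 0 R) x \<partial>lborel)" for k
  have t: "t k > 0" "t k \<le> 1" "t k = 2 * t (Suc k)" for k
    by (auto simp: t_def power_le_one)
  have cont [measurable]: "f \<in> borel_measurable borel"
    using lipschitz_on_continuous_on[OF lip] by (rule borel_measurable_continuous_onI)
  have [measurable]: "q k \<in> borel_measurable borel" "D k \<in> borel_measurable borel" for k
    unfolding q_def D_def by measurable
  have [measurable]: "cball c s \<in> sets borel" for c :: 'a and s
    by (simp add: borel_closed)
  have pointwise: "q k x + D (Suc k) x = ennreal (1/2) * q (Suc k) x + ennreal (1/2) * q (Suc k) (x + t (Suc k) *\<^sub>R d)" for k x
  proof -
    let ?s = "t (Suc k)"
    \<comment> \<open>The increments over the two halves of a step of length \<open>t k\<close>.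
      Their sum is the whole increment and their difference the second difference, so the
      parallelogram law applies.\<close>
    define u where "u = f (x + ?s *\<^sub>R d) - f x"
    define w where "w = f (x + t k *\<^sub>R d) - f (x + ?s *\<^sub>R d)"
    have tk: "t k *\<^sub>R d = ?s *\<^sub>R d + ?s *\<^sub>R d"
      by (simp add: t(3)[of k] flip: scaleR_left.add)
    have 1: "q k x = ennreal ((norm (u + w) / (2 * ?s))\<^sup>2)"
      by (simp add: q_def u_def w_def t(3)[of k])
    have 2: "D (Suc k) x = ennreal ((norm (w - u) / (2 * ?s))\<^sup>2)"
      by (simp add: D_def u_def w_def t(3)[of k] scaleR_2 algebra_simps)
    have 3: "q (Suc k) x = ennreal ((norm u / ?s)\<^sup>2)"
      by (simp add: q_def u_def)
    have 4: "q (Suc k) (x + ?s *\<^sub>R d) = ennreal ((norm w / ?s)\<^sup>2)"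
      by (simp add: q_def w_def tk add.assoc)
    have "(norm (u + w) / (2 * ?s))\<^sup>2 + (norm (w - u) / (2 * ?s))\<^sup>2 = 1/2 * (norm u / ?s)\<^sup>2 + 1/2 * (norm w / ?s)\<^sup>2"
      using t(1)[of "Suc k"]
      by (simp add: power_divide power_mult_distrib power2_norm_eq_inner inner_simps inner_commute field_simps)
    moreover have "ennreal (1/2 * a + 1/2 * b) = ennreal (1/2) * ennreal a + ennreal (1/2) * ennreal b" if "a \<ge> 0" "b \<ge> 0" for a b
      using that by (subst ennreal_mult[symmetric], simp, simp, subst ennreal_mult[symmetric], simp, simp, subst ennreal_plus, auto)
    ultimately show ?thesis
      unfolding 1 2 3 4 by (metis ennreal_plus zero_le_power2)
  qed
  have rR: "cball 0 R \<subseteq> cball (0::'a) (r k)" for k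
    using t(2)[of k] by (auto simp: r_def intro!: subset_cball)
  have r_mono: "cball 0 (r k) \<subseteq> cball (0::'a) (r (Suc k))" for k
    using t[of k] t(1)[of "Suc k"] by (intro subset_cball) (auto simp: r_def intro!: mult_left_mono)
  have r_shift: "x + t (Suc k) *\<^sub>R d \<in> cball 0 (r (Suc k))" if "x \<in> cball 0 (r k)" for x k
  proof -
    have "norm (x + t (Suc k) *\<^sub>R d) \<le> r k + t (Suc k) * norm d"
      using that t(1)[of "Suc k"] by (intro order_trans[OF norm_triangle_ineq]) auto
    also have "\<dots> = r (Suc k)"
      by (simp add: r_def t(3)[of k] algebra_simps)
    finally show ?thesis by simp
  qed
  have step: "I k + J k \<le> I (Suc k)" for k
  proof -
    have "I k + J k \<le> I k + (\<integral>\<^sup>+x. D (Suc k) x * indicator (cball 0 (r k)) x \<partial>lborel)"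
      unfolding J_def using rR[of k] by (intro add_mono nn_integral_mono) (auto split: split_indicator)
    also have "\<dots> = (\<integral>\<^sup>+x. (q k x + D (Suc k) x) * indicator (cball 0 (r k)) x \<partial>lborel)"
      unfolding I_def by (subst nn_integral_add[symmetric]) (measurable, simp add: algebra_simps)
    also have "\<dots> = (\<integral>\<^sup>+x. ennreal (1/2) * (q (Suc k) x * indicator (cball 0 (r k)) x)
        + ennreal (1/2) * (q (Suc k) (x + t (Suc k) *\<^sub>R d) * indicator (cball 0 (r k)) x) \<partial>lborel)"
      unfolding pointwise by (simp add: algebra_simps)
    also have "\<dots> \<le> (\<integral>\<^sup>+x. ennreal (1/2) * (q (Suc k) x * indicator (cball 0 (r (Suc k))) x)
        + ennreal (1/2) * (q (Suc k) (x + t (Suc k) *\<^sub>R d) * indicator (cball 0 (r (Suc k))) (x + t (Suc k) *\<^sub>R d)) \<partial>lborel)"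
      using r_mono[of k] r_shift[of _ k]
      by (intro nn_integral_mono add_mono mult_left_mono) (auto split: split_indicator)
    also have "\<dots> = ennreal (1/2) * I (Suc k) + ennreal (1/2) * I (Suc k)"
      unfolding I_def
      by (simp add: nn_integral_add nn_integral_cmult
            nn_integral_lborel_shift[where g="\<lambda>x. q (Suc k) x * indicator (cball 0 (r (Suc k))) x"])
    also have "\<dots> = (ennreal (1/2) + ennreal (1/2)) * I (Suc k)"
      by (simp add: algebra_simps)
    also have "ennreal (1/2) + ennreal (1/2) = 1"
      by (subst ennreal_plus[symmetric]) auto
    finally show ?thesis by simp
  qed
  have "(\<Sum>k<n. J k) \<le> I n" for n
  proof (induction n)
    case (Suc n)
    have "(\<Sum>k<Suc n. J k) \<le> I n + J n" using Suc by (simp add: add_right_mono)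
    with step[of n] show ?case by (rule order_trans[rotated])
  qed simp
  moreover have "I n \<le> ennreal ((L * norm d)\<^sup>2) * emeasure lborel (cball (0::'a) (R + norm d))" for n
  proof -
    have bd: "q n x * indicator (cball 0 (r n)) x \<le> ennreal ((L * norm d)\<^sup>2) * indicator (cball 0 (R + norm d)) x" for x
    proof -
      have "norm (f (x + t n *\<^sub>R d) - f x) \<le> L * norm (t n *\<^sub>R d)"
        using lipschitz_onD[OF lip, of "x + t n *\<^sub>R d" x] by (simp add: dist_norm)
      then have "norm (f (x + t n *\<^sub>R d) - f x) / t n \<le> L * norm d"
        using t(1)[of n] by (simp add: field_simps)
      then have "q n x \<le> ennreal ((L * norm d)\<^sup>2)"
        unfolding q_def using t(1)[of n] by (intro ennreal_leI power_mono) auto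
      moreover have "r n \<le> R + norm d"
        using t(1)[of n] by (auto simp: r_def mult_left_le)
      ultimately show ?thesis by (auto split: split_indicator)
    qed
    have "I n \<le> (\<integral>\<^sup>+x. ennreal ((L * norm d)\<^sup>2) * indicator (cball (0::'a) (R + norm d)) x \<partial>lborel)"
      unfolding I_def by (intro nn_integral_mono bd)
    then show ?thesis by (simp add: nn_integral_cmult_indicator)
  qed
  ultimately have "(\<Sum>k<n. J k) \<le> ennreal ((L * norm d)\<^sup>2) * emeasure lborel (cball (0::'a) (R + norm d))" for n
    by (rule order_trans)
  then have "(\<Sum>k. J k) \<le> ennreal ((L * norm d)\<^sup>2) * emeasure lborel (cball (0::'a) (R + norm d))"
    by (intro suminf_le_const) auto
  also have "\<dots> < \<infinity>"
    using emeasure_bounded_finite[OF bounded_cball[of "0::'a" "R + norm d"]]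
    by (auto simp: ennreal_mult_less_top)
  finally show ?thesis by (simp add: J_def)
qed

text \<open>A summable energy makes the sum of squares finite almost everywhere, so its terms tend
  to 0. The base point \<open>x + t k *\<^sub>R a\<close> moves with \<open>k\<close>, hence the
  exceptional set for a fixed base point cannot be reused; instead the translated energies are
  summed, and the shift, at most \<open>norm a\<close>, is absorbed by a larger ball.\<close>

lemma AE_second_difference_tendsto_0:
  fixes f :: "'a::euclidean_space \<Rightarrow> 'b::euclidean_space" and a d :: 'a
  assumes lip: "L-lipschitz_on UNIV f"
  defines "t \<equiv> \<lambda>k::nat. (1/2)^k :: real"
  shows "AE x in lborel. (\<lambda>k. (1 / t k) *\<^sub>R (f (x + t k *\<^sub>R (a + 2 *\<^sub>R d)) - 2 *\<^sub>R f (x + t k *\<^sub>R (a + d)) + f (x + t k *\<^sub>R a)))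
    \<longlonglongrightarrow> 0"
proof -
  define g where "g k x = (1 / (2 * t k)) *\<^sub>R (f (x + (2 * t k) *\<^sub>R d) - 2 *\<^sub>R f (x + t k *\<^sub>R d) + f x)" for k x
  define D where "D k x = ennreal ((norm (g k x))\<^sup>2)" for k x
  have t: "t k > 0" "t k \<le> 1" for k
    by (auto simp: t_def power_le_one)
  have cont [measurable]: "f \<in> borel_measurable borel"
    using lipschitz_on_continuous_on[OF lip] by (rule borel_measurable_continuous_onI)
  have [measurable]: "D k \<in> borel_measurable borel" for k
    unfolding D_def g_def by measurable
  have [measurable]: "cball c s \<in> sets borel" for c :: 'a and s
    by (simp add: borel_closed)
  have "AE x in lborel. norm x \<le> real m \<longrightarrow> (\<lambda>k. g (Suc k) (x + t (Suc k) *\<^sub>R a)) \<longlonglongrightarrow> 0" for m :: nat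
  proof -
    define R where "R = real m + norm a"
    have D_alt: "D k = (\<lambda>x. ennreal ((norm (f (x + (2 * t k) *\<^sub>R d) - 2 *\<^sub>R f (x + t k *\<^sub>R d) + f x) / (2 * t k))\<^sup>2))" for k
      using t(1)[of k] by (auto simp: D_def g_def fun_eq_iff divide_simps)
    have fin: "(\<Sum>k. \<integral>\<^sup>+x. D (Suc k) x * indicator (cball 0 R) x \<partial>lborel) < \<infinity>"
      using dyadic_energy_summable[OF lip, where d=d and R=R] unfolding D_alt t_def .
    have le: "(\<integral>\<^sup>+x. D (Suc k) (x + t (Suc k) *\<^sub>R a) * indicator (cball 0 (real m)) x \<partial>lborel)
        \<le> (\<integral>\<^sup>+x. D (Suc k) x * indicator (cball 0 R) x \<partial>lborel)" for k
    proof -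
      have "x + t (Suc k) *\<^sub>R a \<in> cball 0 R" if "x \<in> cball 0 (real m)" for x
      proof -
        have "norm (x + t (Suc k) *\<^sub>R a) \<le> norm x + t (Suc k) * norm a"
          using norm_triangle_ineq[of x "t (Suc k) *\<^sub>R a"] t(1)[of "Suc k"] by simp
        also have "\<dots> \<le> R"
          using that t[of "Suc k"] by (auto simp: R_def intro!: add_mono mult_left_le_one_le)
        finally show ?thesis by simp
      qed
      then have "(\<integral>\<^sup>+x. D (Suc k) (x + t (Suc k) *\<^sub>R a) * indicator (cball 0 (real m)) x \<partial>lborel)
        \<le> (\<integral>\<^sup>+x. D (Suc k) (x + t (Suc k) *\<^sub>R a) * indicator (cball 0 R) (x + t (Suc k) *\<^sub>R a) \<partial>lborel)"
        by (intro nn_integral_mono) (auto split: split_indicator)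
      also have "\<dots> = (\<integral>\<^sup>+x. D (Suc k) x * indicator (cball 0 R) x \<partial>lborel)"
        by (rule nn_integral_lborel_shift) measurable
      finally show ?thesis .
    qed
    have "(\<integral>\<^sup>+x. (\<Sum>k. D (Suc k) (x + t (Suc k) *\<^sub>R a) * indicator (cball 0 (real m)) x) \<partial>lborel) 
        = (\<Sum>k. \<integral>\<^sup>+x. D (Suc k) (x + t (Suc k) *\<^sub>R a) * indicator (cball 0 (real m)) x \<partial>lborel)"
      by (rule nn_integral_suminf) measurable
    also have "\<dots> \<le> (\<Sum>k. \<integral>\<^sup>+x. D (Suc k) x * indicator (cball 0 R) x \<partial>lborel)"
      by (intro suminf_le le) auto
    also note fin
    finally have "(\<integral>\<^sup>+x. (\<Sum>k. D (Suc k) (x + t (Suc k) *\<^sub>R a) * indicator (cball 0 (real m)) x) \<partial>lborel) \<noteq> \<infinity>"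
      by (rule less_imp_neq)
    then have "AE x in lborel. (\<Sum>k. D (Suc k) (x + t (Suc k) *\<^sub>R a) * indicator (cball 0 (real m)) x) \<noteq> \<infinity>"
      by (rule nn_integral_PInf_AE[rotated]) measurable
    then show ?thesis
    proof eventually_elim
      case (elim x)
      show ?case
      proof
        assume "norm x \<le> real m"
        with elim have "(\<Sum>k. D (Suc k) (x + t (Suc k) *\<^sub>R a)) \<noteq> top" by simp
        then have "summable (\<lambda>k. (norm (g (Suc k) (x + t (Suc k) *\<^sub>R a)))\<^sup>2)"
          unfolding D_def by (intro summable_suminf_not_top) auto
        then have "(\<lambda>k. (norm (g (Suc k) (x + t (Suc k) *\<^sub>R a)))\<^sup>2) \<longlonglongrightarrow> 0"
          by (rule summable_LIMSEQ_zero)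
        then have "(\<lambda>k. sqrt ((norm (g (Suc k) (x + t (Suc k) *\<^sub>R a)))\<^sup>2)) \<longlonglongrightarrow> sqrt 0"
          by (rule tendsto_real_sqrt)
        then show "(\<lambda>k. g (Suc k) (x + t (Suc k) *\<^sub>R a)) \<longlonglongrightarrow> 0"
          by (simp add: tendsto_norm_zero_iff)
      qed
    qed
  qed
  then have "AE x in lborel. \<forall>m. norm x \<le> real m \<longrightarrow> (\<lambda>k. g (Suc k) (x + t (Suc k) *\<^sub>R a)) \<longlonglongrightarrow> 0"
    by (subst AE_all_countable) auto
  then show ?thesis
  proof eventually_elim
    case (elim x)
    then have "(\<lambda>k. g (Suc k) (x + t (Suc k) *\<^sub>R a)) \<longlonglongrightarrow> 0"
      using real_arch_simple[of "norm x"] by blast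
    then have "(\<lambda>k. g k (x + t k *\<^sub>R a)) \<longlonglongrightarrow> 0"
      by (subst (asm) filterlim_sequentially_Suc)
    then have "(\<lambda>k. 2 *\<^sub>R g k (x + t k *\<^sub>R a)) \<longlonglongrightarrow> 2 *\<^sub>R 0"
      by (intro tendsto_scaleR tendsto_const)
    moreover have "2 *\<^sub>R g k (x + t k *\<^sub>R a) = (1 / t k) *\<^sub>R (f (x + t k *\<^sub>R (a + 2 *\<^sub>R d)) - 2 *\<^sub>R f (x + t k *\<^sub>R (a + d)) + f (x + t k *\<^sub>R a))" for k
      by (simp add: g_def algebra_simps)
    ultimately show ?case by simp
  qed
qed

text \<open>Multiplied by \<open>n\<close>, the defect of homogeneity at \<open>c\<close> reduces by
  additivity to that at the fractional part of \<open>n * c\<close>, which is bounded independently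
  of \<open>n\<close>. So the defect is zero.\<close>

lemma additive_Lipschitz_imp_linear:
  fixes g :: "'a::real_normed_vector \<Rightarrow> 'b::real_normed_vector"
  assumes add: "\<And>x y. g (x + y) = g x + g y" and bd: "\<And>x. norm (g x) \<le> L * norm x"
  shows "linear g"
proof -
  interpret additive g by standard (rule add)
  have nat: "g (real n *\<^sub>R x) = real n *\<^sub>R g x" for n x
    by (induction n) (auto simp: algebra_simps zero add)
  have int: "g (real_of_int n *\<^sub>R x) = real_of_int n *\<^sub>R g x" for n x
  proof (cases "n \<ge> 0")
    case True
    then show ?thesis using nat[of "nat n" x] by simp
  next
    case False
    then show ?thesis using nat[of "nat (-n)" x] by (simp add: minus)
  qed
  have L: "L * norm x \<ge> 0" for x :: 'a
    using bd[of x] norm_ge_zero[of "g x"] by linarith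
  have "g (c *\<^sub>R x) = c *\<^sub>R g x" for c x
  proof -
    have "real n * norm (g (c *\<^sub>R x) - c *\<^sub>R g x) \<le> 2 * (L * norm x)" for n
    proof -
      define m where "m = \<lfloor>real n * c\<rfloor>"
      define r where "r = real n * c - of_int m"
      have r: "\<bar>r\<bar> \<le> 1" unfolding r_def m_def by linarith
      have nc: "real n * c = of_int m + r" by (simp add: r_def)
      have "real n *\<^sub>R g (c *\<^sub>R x) = g (of_int m *\<^sub>R x + r *\<^sub>R x)"
        using nat[of n "c *\<^sub>R x"] by (simp add: nc flip: scaleR_left.add)
      then have "real n *\<^sub>R (g (c *\<^sub>R x) - c *\<^sub>R g x) = g (r *\<^sub>R x) - r *\<^sub>R g x"
        by (simp add: add int scaleR_diff_right nc scaleR_left.add)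
      then have "real n * norm (g (c *\<^sub>R x) - c *\<^sub>R g x) = norm (g (r *\<^sub>R x) - r *\<^sub>R g x)"
        by (metis norm_scaleR abs_of_nat)
      also have "\<dots> \<le> norm (g (r *\<^sub>R x)) + \<bar>r\<bar> * norm (g x)"
        by (metis norm_triangle_ineq4 norm_scaleR)
      also have "\<dots> \<le> \<bar>r\<bar> * (L * norm x) + \<bar>r\<bar> * (L * norm x)"
        using bd[of "r *\<^sub>R x"] bd[of x] by (intro add_mono mult_left_mono) (auto simp: mult_ac)
      also have "\<dots> \<le> 1 * (L * norm x) + 1 * (L * norm x)"
        using r L[of x] by (intro add_mono mult_right_mono) auto
      finally show ?thesis by simp
    qed
    then have "\<not> 0 < norm (g (c *\<^sub>R x) - c *\<^sub>R g x)"
      using reals_Archimedean3[of "norm (g (c *\<^sub>R x) - c *\<^sub>R g x)"] by (metis not_le)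
    then show ?thesis by simp
  qed
  with add show ?thesis by (intro linearI)
qed

text \<open>Extension by dyadic scaling: the midpoint identity with one point 0 says that halving
  the argument halves the value, so the number of halvings in \<open>G\<close> is immaterial once
  the argument lies in the unit ball. The identity is needed up to radius 2 to be applied freely to
  points of norm at most 1.\<close>

lemma midpoint_affine_on_ball_imp_linear:
  fixes g :: "'a::real_normed_vector \<Rightarrow> 'b::real_normed_vector"
  assumes mid: "\<And>x y. norm x < 2 \<Longrightarrow> norm y < 2 \<Longrightarrow> g x + g y = 2 *\<^sub>R g ((1/2) *\<^sub>R (x + y))"
    and zero: "g 0 = 0" and bd: "\<And>x. norm x \<le> 1 \<Longrightarrow> norm (g x) \<le> L * norm x"
  obtains G where "linear G" "\<And>x. norm x \<le> 1 \<Longrightarrow> G x = g x"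
proof -
  define n where "n x = nat \<lceil>norm x\<rceil>" for x :: 'a
  define G where "G x = 2 ^ n x *\<^sub>R g ((1/2) ^ n x *\<^sub>R x)" for x
  have n: "norm x \<le> 2 ^ n x" for x
    using of_nat_less_two_power[of "n x", where 'a=real] unfolding n_def by linarith
  have scaled: "norm ((1/2) ^ m *\<^sub>R x) \<le> 1" if "norm x \<le> 2 ^ k" "k \<le> m" for x :: 'a and k m
  proof -
    have "norm x \<le> 2 ^ m"
      using that power_increasing[of k m "2::real"] by linarith
    then show ?thesis by (simp add: field_simps)
  qed
  have indep: "2 ^ m *\<^sub>R g ((1/2) ^ m *\<^sub>R x) = 2 ^ k *\<^sub>R g ((1/2) ^ k *\<^sub>R x)" if "norm x \<le> 2 ^ k" "k \<le> m" for x k m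
    using that(2)
  proof (induction rule: dec_induct)
    case (step m)
    have "norm ((1/2) ^ m *\<^sub>R x) < 2" using scaled[OF that(1) step.hyps(1)] by linarith
    from mid[OF this, of 0] have "g ((1/2) ^ m *\<^sub>R x) = 2 *\<^sub>R g ((1/2) ^ Suc m *\<^sub>R x)"
      by (simp add: zero)
    then have "2 ^ Suc m *\<^sub>R g ((1/2) ^ Suc m *\<^sub>R x) = 2 ^ m *\<^sub>R g ((1/2) ^ m *\<^sub>R x)"
      by (simp add: mult.commute)
    with step.IH show ?case by simp
  qed simp
  have G: "G x = 2 ^ m *\<^sub>R g ((1/2) ^ m *\<^sub>R x)" if "n x \<le> m" for x m
    unfolding G_def using indep[OF n that] by simp
  have "linear G"
  proof (rule additive_Lipschitz_imp_linear)
    fix x y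
    define m where "m = max (n x) (max (n y) (n (x + y)))"
    define u where "u = (1/2) ^ m *\<^sub>R x"
    define v where "v = (1/2) ^ m *\<^sub>R y"
    have m: "n x \<le> m" "n y \<le> m" "n (x + y) \<le> m" by (auto simp: m_def)
    have uv: "norm u \<le> 1" "norm v \<le> 1" "norm (u + v) \<le> 1"
      using scaled[OF n m(1)] scaled[OF n m(2)] scaled[OF n m(3)]
      by (auto simp: u_def v_def scaleR_add_right)
    have "g u + g v = 2 *\<^sub>R g ((1/2) *\<^sub>R (u + v))" using uv by (intro mid) auto
    also have "\<dots> = g (u + v)" using mid[of "u + v" 0] uv by (simp add: zero)
    finally show "G (x + y) = G x + G y"
      by (simp add: G[OF m(1)] G[OF m(2)] G[OF m(3)] u_def v_def flip: scaleR_add_right)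
  next
    fix x
    show "norm (G x) \<le> L * norm x"
      unfolding G_def using bd[OF scaled[OF n order_refl], of x] by (simp add: field_simps)
  qed
  moreover have "G x = g x" if "norm x \<le> 1" for x
    using indep[of x 0 "n x"] that by (simp add: G_def)
  ultimately show ?thesis by (rule that)
qed

text \<open>A substitute for Rademacher's theorem: the blow-ups at almost every point accumulate only at
  functions with vanishing second differences. Nothing is claimed about different scales having the same
  linear part.\<close>

theorem lipschitz_affine_at_small_scales:
  fixes f :: "'a::euclidean_space \<Rightarrow> 'b::euclidean_space"
  assumes lip: "L-lipschitz_on UNIV f"
  shows "AE z in lborel. \<forall>\<eta>>0. \<forall>r>0. \<exists>\<rho> M. 0 < \<rho> \<and> \<rho> < r \<and> linear M \<and>
    (\<forall>h. norm h \<le> \<rho> \<longrightarrow> norm (f (z + h) - f z - M h) \<le> \<eta> * \<rho>)"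
proof -
  define t where "t k = ((1/2)^k :: real)" for k :: nat
  have t: "t k > 0" for k by (simp add: t_def)
  \<comment> \<open>Countability allows one null set for all pairs of directions; density and the
    Lipschitz bound later restore the remaining directions.\<close>
  obtain Q :: "'a set" where Q: "countable Q" "\<And>X. open X \<Longrightarrow> X \<noteq> {} \<Longrightarrow> \<exists>d\<in>Q. d \<in> X"
    using countable_dense_setE by blast
  have "AE z in lborel. \<forall>a\<in>Q. \<forall>d\<in>Q. (\<lambda>k. (1 / t k) *\<^sub>R (f (z + t k *\<^sub>R (a + 2 *\<^sub>R d)) - 2 *\<^sub>R f (z + t k *\<^sub>R (a + d)) + f (z + t k *\<^sub>R a)))
    \<longlonglongrightarrow> 0"
    unfolding AE_ball_countable[OF Q(1)] t_def using AE_second_difference_tendsto_0[OF lip] by blast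
  then show ?thesis
  proof eventually_elim
    case (elim z)
    have L: "L \<ge> 0" using lip by (rule lipschitz_on_nonneg)
    \<comment> \<open>The blow-ups of \<open>f\<close> at \<open>z\<close> share the Lipschitz
      constant \<open>L\<close> and vanish at 0, so Arzela-Ascoli gives a uniform limit along a
      subsequence of scales.\<close>
    define F where "F k h = (1 / t k) *\<^sub>R (f (z + t k *\<^sub>R h) - f z)" for k h
    have F_lip: "norm (F k x - F k y) \<le> L * norm (x - y)" for k x y
    proof -
      have "F k x - F k y = (1 / t k) *\<^sub>R (f (z + t k *\<^sub>R x) - f (z + t k *\<^sub>R y))"
        by (simp add: F_def algebra_simps)
      moreover have "norm (f (z + t k *\<^sub>R x) - f (z + t k *\<^sub>R y)) \<le> L * (t k * norm (x - y))"
        using lipschitz_onD[OF lip, of "z + t k *\<^sub>R x" "z + t k *\<^sub>R y"] t[of k]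
        by (simp add: dist_norm flip: scaleR_diff_right)
      ultimately show ?thesis using t[of k] by (simp add: divide_le_eq mult_ac)
    qed
    have F0: "F k 0 = 0" for k by (simp add: F_def)
    obtain g \<kappa> where g: "continuous_on (cball 0 2) g" "strict_mono (\<kappa> :: nat \<Rightarrow> nat)"
      "\<And>e. 0 < e \<Longrightarrow> \<exists>N. \<forall>n x. n \<ge> N \<and> x \<in> cball 0 2 \<longrightarrow> norm (F (\<kappa> n) x - g x) < e"
    proof (rule Arzela_Ascoli[of "cball 0 2" F "L * 2"])
      show "norm (F n x) \<le> L * 2" if "x \<in> cball 0 2" for n x
        using F_lip[of n x 0] that L by (simp add: F0) (meson mult_left_mono order_trans)
      show "\<exists>d>0. \<forall>n y. y \<in> cball 0 2 \<and> norm (x - y) < d \<longrightarrow> norm (F n x - F n y) < e"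
        if "x \<in> cball 0 2" "0 < e" for x e
      proof (intro exI[of _ "e / (L + 1)"] conjI allI impI)
        show "0 < e / (L + 1)" using that L by simp
        fix n y assume "y \<in> cball 0 2 \<and> norm (x - y) < e / (L + 1)"
        then have "(L + 1) * norm (x - y) < e" using L by (simp add: field_simps)
        moreover have "norm (F n x - F n y) \<le> (L + 1) * norm (x - y)"
          using F_lip[of n x y] by (simp add: distrib_right add_increasing2)
        ultimately show "norm (F n x - F n y) < e" by linarith
      qed
    qed auto
    have lim: "(\<lambda>n. F (\<kappa> n) x) \<longlonglongrightarrow> g x" if "norm x \<le> 2" for x
      using g(3) that by (intro LIMSEQ_I) (metis mem_cball_0)
    have g0: "g 0 = 0"
      using lim[of 0] by (simp add: F0 LIMSEQ_const_iff)
    have g_lip: "norm (g x - g y) \<le> L * norm (x - y)" if "norm x \<le> 2" "norm y \<le> 2" for x y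
      by (rule tendsto_upperbound[OF tendsto_norm[OF tendsto_diff[OF lim[OF that(1)] lim[OF that(2)]]]])
        (auto simp: F_lip)
    have jensen_Q: "g (a + 2 *\<^sub>R d) - 2 *\<^sub>R g (a + d) + g a = 0"
      if "a \<in> Q" "d \<in> Q" "norm a \<le> 2" "norm (a + d) \<le> 2" "norm (a + 2 *\<^sub>R d) \<le> 2" for a d
    proof -
      have *: "s *\<^sub>R (u - c) - 2 *\<^sub>R (s *\<^sub>R (v - c)) + s *\<^sub>R (w - c) = s *\<^sub>R (u - 2 *\<^sub>R v + w)" for s and u v w c :: 'b
        unfolding scaleR_2 by (simp add: scaleR_right_diff_distrib scaleR_right_distrib)
      have "(\<lambda>k. F k (a + 2 *\<^sub>R d) - 2 *\<^sub>R F k (a + d) + F k a) \<longlonglongrightarrow> 0"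
        using elim that(1,2) unfolding F_def * by blast
      then have "(\<lambda>n. F (\<kappa> n) (a + 2 *\<^sub>R d) - 2 *\<^sub>R F (\<kappa> n) (a + d) + F (\<kappa> n) a) \<longlonglongrightarrow> 0"
        using LIMSEQ_subseq_LIMSEQ[OF _ g(2)] by (fastforce simp: o_def)
      moreover have "(\<lambda>n. F (\<kappa> n) (a + 2 *\<^sub>R d) - 2 *\<^sub>R F (\<kappa> n) (a + d) + F (\<kappa> n) a) \<longlonglongrightarrow>
          g (a + 2 *\<^sub>R d) - 2 *\<^sub>R g (a + d) + g a"
        by (intro tendsto_intros lim that)
      ultimately show ?thesis using LIMSEQ_unique by blast
    qed
    have jensen: "g x + g y = 2 *\<^sub>R g ((1/2) *\<^sub>R (x + y))" if x: "norm x < 2" and y: "norm y < 2" for x y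
    proof -
      define m where "m = (1/2) *\<^sub>R (x + y)"
      have m: "norm m < 2"
        using norm_triangle_ineq[of x y] x y by (simp add: m_def)
      have "norm (g y - 2 *\<^sub>R g m + g x) \<le> e" if "e > 0" for e
      proof -
        \<comment> \<open>The points \<open>a\<close>, \<open>a + d\<close> and
          \<open>a + 2 *\<^sub>R d\<close> will be within \<open>e'\<close>, \<open>2 * e'\<close>
          and \<open>3 * e'\<close> of \<open>x\<close>, \<open>m\<close> and \<open>y\<close>. The
          quarters keep them in the ball of radius 2, and the Lipschitz errors add up to
          \<open>8 * L * e'\<close>; \<open>L + 1\<close> avoids division by 0.\<close>
        define e' where "e' = min (e / (8 * (L + 1))) (min ((2 - norm x) / 4) (min ((2 - norm y) / 4) ((2 - norm m) / 4)))"
        have "e' > 0" using that x y m L by (simp add: e'_def)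
        moreover have "e' \<le> e / (8 * (L + 1))" "e' \<le> (2 - norm x) / 4" "e' \<le> (2 - norm y) / 4" "e' \<le> (2 - norm m) / 4"
          unfolding e'_def by linarith+
        ultimately have e': "e' > 0" "4 * e' \<le> 2 - norm x" "4 * e' \<le> 2 - norm y" "4 * e' \<le> 2 - norm m" "8 * (L + 1) * e' \<le> e"
          using L by (simp_all add: pos_le_divide_eq mult.commute)
        obtain a where a: "a \<in> Q" "norm (a - x) < e'"
          using Q(2)[of "ball x e'"] e'(1) by (auto simp: dist_norm norm_minus_commute)
        obtain d where d: "d \<in> Q" "norm (d - (1/2) *\<^sub>R (y - x)) < e'"
          using Q(2)[of "ball ((1/2) *\<^sub>R (y - x)) e'"] e'(1) by (auto simp: dist_norm norm_minus_commute)
        have "(1/2) *\<^sub>R (y - x) = (1/2) *\<^sub>R (x + y) - (1/2 + 1/2) *\<^sub>R x"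
          unfolding scaleR_left.add scaleR_add_right scaleR_diff_right by simp
        then have "(1/2) *\<^sub>R (y - x) = m - x" by (simp add: m_def)
        then have ad: "norm (a + d - m) \<le> 2 * e'"
          using norm_triangle_ineq[of "a - x" "d - (1/2) *\<^sub>R (y - x)"] a d by (simp add: algebra_simps)
        have "(a + 2 *\<^sub>R d) - y = (a - x) + 2 *\<^sub>R (d - (1/2) *\<^sub>R (y - x))"
          by (simp add: algebra_simps)
        then have "norm (a + 2 *\<^sub>R d - y) \<le> norm (a - x) + norm (2 *\<^sub>R (d - (1/2) *\<^sub>R (y - x)))"
          by (simp only: norm_triangle_ineq)
        then have add: "norm (a + 2 *\<^sub>R d - y) \<le> 3 * e'"
          using a d by simp
        have bounds: "norm a \<le> 2" "norm (a + d) \<le> 2" "norm (a + 2 *\<^sub>R d) \<le> 2"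
          using norm_triangle_sub[of a x] norm_triangle_sub[of "a + d" m] norm_triangle_sub[of "a + 2 *\<^sub>R d" y]
            a(2) ad add e' by linarith+
        have "g y - 2 *\<^sub>R g m + g x = (g y - g (a + 2 *\<^sub>R d)) - 2 *\<^sub>R (g m - g (a + d)) + (g x - g a)"
          using jensen_Q[OF a(1) d(1) bounds] by (simp add: algebra_simps)
        also have "norm \<dots> \<le> norm (g y - g (a + 2 *\<^sub>R d)) + 2 * norm (g m - g (a + d)) + norm (g x - g a)"
        proof -
          have "norm (u - 2 *\<^sub>R v + w) \<le> norm u + 2 * norm v + norm w" for u v w :: 'b
            using norm_triangle_ineq[of "u - 2 *\<^sub>R v" w] norm_triangle_ineq4[of u "2 *\<^sub>R v"] by simp
          then show ?thesis .
        qed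
        also have "\<dots> \<le> L * norm (y - (a + 2 *\<^sub>R d)) + 2 * (L * norm (m - (a + d))) + L * norm (x - a)"
          using bounds x y m by (intro add_mono mult_left_mono g_lip) auto
        also have "\<dots> \<le> L * (3 * e') + 2 * (L * (2 * e')) + L * e'"
          using ad add a(2) L by (intro add_mono mult_left_mono) (auto simp: norm_minus_commute)
        also have "\<dots> = 8 * L * e'" by simp
        also have "\<dots> \<le> 8 * (L + 1) * e'" using e'(1) by simp
        also note e'(5)
        finally show ?thesis .
      qed
      then have "norm (g y - 2 *\<^sub>R g m + g x) \<le> 0"
        using field_le_epsilon[of "norm (g y - 2 *\<^sub>R g m + g x)" 0] by simp
      then show ?thesis by (simp add: m_def algebra_simps)
    qed
    obtain G where G: "linear G" "\<And>x. norm x \<le> 1 \<Longrightarrow> G x = g x"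
      using midpoint_affine_on_ball_imp_linear[of g L] jensen g0 g_lip[of _ 0] by auto
    show ?case
    proof (intro allI impI)
      fix \<eta> r :: real assume "\<eta> > 0" "r > 0"
      obtain N where N: "\<And>n x. n \<ge> N \<Longrightarrow> norm x \<le> 2 \<Longrightarrow> norm (F (\<kappa> n) x - g x) < \<eta>"
        using g(3)[OF \<open>\<eta> > 0\<close>] by auto
      obtain K where K: "t K < r"
        unfolding t_def using real_arch_pow_inv[OF \<open>r > 0\<close>, of "1/2"] by auto
      \<comment> \<open>\<open>n \<ge> N\<close> gives closeness to the limit, and
        \<open>n \<ge> K\<close> gives a scale below \<open>r\<close>, because
        \<open>\<kappa> n \<ge> n\<close>.\<close>
      define n where "n = max N K"
      define \<rho> where "\<rho> = t (\<kappa> n)"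
      have "K \<le> \<kappa> n" using seq_suble[OF g(2), of n] by (simp add: n_def)
      then have "t (\<kappa> n) \<le> t K" by (simp add: t_def power_decreasing)
      then have \<rho>: "0 < \<rho>" "\<rho> < r"
        using K by (auto simp: \<rho>_def t)
      have "norm (f (z + h) - f z - G h) \<le> \<eta> * \<rho>" if "norm h \<le> \<rho>" for h
      proof -
        define x where "x = (1 / \<rho>) *\<^sub>R h"
        have x: "norm x \<le> 1" "h = \<rho> *\<^sub>R x" using that \<rho> by (auto simp: x_def field_simps)
        have "f (z + h) - f z - G h = \<rho> *\<^sub>R (F (\<kappa> n) x - g x)"
          using \<rho> by (simp add: x(2) F_def linear_scale[OF G(1)] G(2)[OF x(1)] scaleR_diff_right flip: \<rho>_def)
        moreover have "norm (F (\<kappa> n) x - g x) \<le> \<eta>" using N[of n x] x by (simp add: n_def)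
        ultimately show ?thesis using \<rho> by (simp add: mult.commute)
      qed
      with \<rho> G(1) show "\<exists>\<rho> M. 0 < \<rho> \<and> \<rho> < r \<and> linear M \<and> (\<forall>h. norm h \<le> \<rho> \<longrightarrow> norm (f (z + h) - f z - M h) \<le> \<eta> * \<rho>)"
        by blast
    qed
  qed
qed

section \<open>Semiconvex functions, hulls and contact sets\<close>

text \<open>Midpoint convexity of \<open>A x + k / 2 * (norm x)^2\<close>, written as a one-sided
  bound on second differences.\<close>

definition semiconvex :: "real \<Rightarrow> ('a::real_normed_vector \<Rightarrow> real) \<Rightarrow> bool" where
  "semiconvex k A \<longleftrightarrow> (\<forall>x h. 2 * A x \<le> A (x + h) + A (x - h) + k * (norm h)\<^sup>2)"

text \<open>Up to the value of the constant, this says that \<open>p\<close> is the gradient of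
  \<open>H\<close> and is Lipschitz.\<close>

definition quadratic_expansion :: "real \<Rightarrow> ('a::real_inner \<Rightarrow> real) \<Rightarrow> ('a \<Rightarrow> 'a) \<Rightarrow> bool" where
  "quadratic_expansion \<Lambda> H p \<longleftrightarrow> (\<forall>x h. \<bar>H (x + h) - H x - p x \<bullet> h\<bar> \<le> \<Lambda> * (norm h)\<^sup>2)"

lemma quadratic_expansion_derivative:
  assumes "quadratic_expansion \<Lambda> H p"
  shows "(H has_derivative (\<lambda>h. p x \<bullet> h)) (at x)"
proof (rule has_derivativeI_sandwich[of 1])
  show "bounded_linear ((\<bullet>) (p x))" by (rule bounded_linear_inner_right)
  fix y assume "y \<noteq> x" "dist y x < 1"
  have "\<bar>H y - H x - p x \<bullet> (y - x)\<bar> \<le> \<Lambda> * (norm (y - x))\<^sup>2"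
    using assms[unfolded quadratic_expansion_def, rule_format, of x "y - x"] by simp
  then show "norm (H y - H x - p x \<bullet> (y - x)) / norm (y - x) \<le> \<Lambda> * norm (y - x)"
    using \<open>y \<noteq> x\<close> by (simp add: divide_le_eq power2_eq_square mult.assoc)
next
  have "((\<lambda>y. \<Lambda> * norm (y - x)) \<longlongrightarrow> \<Lambda> * norm (x - x)) (at x)"
    by (intro tendsto_intros)
  then show "((\<lambda>y. \<Lambda> * norm (y - x)) \<longlongrightarrow> 0) (at x)" by simp
qed auto

text \<open>The difference of the slopes is tested in its own direction, with a step
  \<open>h\<close> as long as \<open>e = y - x\<close>. Three expansions, over \<open>h\<close>,
  \<open>e + h\<close> and \<open>e\<close>, contribute 1 + 4 + 1 = 6.\<close>

lemma quadratic_expansion_lipschitz: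
  fixes p :: "'a::real_inner \<Rightarrow> 'a"
  assumes exp: "quadratic_expansion \<Lambda> H p" and \<Lambda>: "\<Lambda> \<ge> 0"
  shows "(6 * \<Lambda>)-lipschitz_on UNIV p"
proof (rule lipschitz_onI)
  fix x y :: 'a
  have E: "\<bar>H (x + h) - H x - p x \<bullet> h\<bar> \<le> \<Lambda> * (norm h)\<^sup>2" for x h
    using exp unfolding quadratic_expansion_def by blast
  define e where "e = y - x"
  define h where "h = (norm e / norm (p y - p x)) *\<^sub>R (p y - p x)"
  show "dist (p x) (p y) \<le> 6 * \<Lambda> * dist x y"
  proof (cases "p y = p x")
    case False
    then have h: "norm h = norm e" "(p y - p x) \<bullet> h = norm e * norm (p y - p x)"
      by (auto simp: h_def dot_square_norm power2_eq_square)
    have "(p y - p x) \<bullet> h \<le> \<Lambda> * (norm h)\<^sup>2 + \<Lambda> * (norm (e + h))\<^sup>2 + \<Lambda> * (norm e)\<^sup>2"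
    proof -
      have "p y \<bullet> h \<le> H (y + h) - H y + \<Lambda> * (norm h)\<^sup>2"
        using E[of y h] unfolding abs_le_iff by linarith
      moreover have "H (x + (e + h)) \<le> H x + p x \<bullet> (e + h) + \<Lambda> * (norm (e + h))\<^sup>2"
        using E[of x "e + h"] unfolding abs_le_iff by linarith
      moreover have "H x + p x \<bullet> e - \<Lambda> * (norm e)\<^sup>2 \<le> H (x + e)"
        using E[of x e] unfolding abs_le_iff by linarith
      moreover have "x + e = y" "x + (e + h) = y + h" by (simp_all add: e_def)
      ultimately show ?thesis by (simp add: inner_diff_left inner_add_right)
    qed
    also have "\<dots> \<le> \<Lambda> * (norm e)\<^sup>2 + \<Lambda> * (norm e + norm e)\<^sup>2 + \<Lambda> * (norm e)\<^sup>2"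
      using \<Lambda> norm_triangle_ineq[of e h] h(1)
      by (intro add_mono mult_left_mono power_mono) auto
    also have "\<dots> = norm e * (6 * \<Lambda> * norm e)" by (simp add: power2_eq_square)
    finally have *: "norm e * norm (p y - p x) \<le> norm e * (6 * \<Lambda> * norm e)" using h(2) by simp
    have "norm e \<noteq> 0" using False by (auto simp: e_def)
    with * have "norm (p y - p x) \<le> 6 * \<Lambda> * norm e" by simp
    then show ?thesis by (simp add: e_def dist_norm norm_minus_commute)
  next
    case True
    then show ?thesis using \<Lambda> by simp
  qed
next
  show "0 \<le> 6 * \<Lambda>" using \<Lambda> by simp
qed

text \<open>The infimum of all paraboloids of opening \<open>2 C\<close> lying above \<open>A\<close>: a regularisation which is
  continuously differentiable with Lipschitz gradient for semiconvex \<open>A\<close> and does not raise \<open>A\<close> at contact points.\<close>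

definition upper_hull :: "real \<Rightarrow> ('a::real_inner \<Rightarrow> real) \<Rightarrow> 'a \<Rightarrow> real" where
  "upper_hull C A x = Inf {c. \<exists>p. \<forall>h. A (x + h) \<le> c + p \<bullet> h + C * (norm h)\<^sup>2}"

context
  fixes A :: "'a::euclidean_space \<Rightarrow> real" and C k M :: real
  assumes sc: "semiconvex k A" and C: "C > 0" and k: "k \<ge> 0"
    and above: "\<And>x. A x \<le> M" and cont: "continuous_on UNIV A"
begin

lemma upper_hull_lower: "A x \<le> upper_hull C A x"
proof -
  have "A (x + h) \<le> M + 0 \<bullet> h + C * (norm h)\<^sup>2" for h
    using above[of "x + h"] C by (simp add: add_increasing2)
  then have "M \<in> {c. \<exists>p. \<forall>h. A (x + h) \<le> c + p \<bullet> h + C * (norm h)\<^sup>2}"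
    by blast
  then show ?thesis
    unfolding upper_hull_def by (intro cInf_greatest) (auto dest: spec[of _ 0])
qed

lemma upper_hull_le:
  assumes "\<And>h. A (x + h) \<le> c + p \<bullet> h + C * (norm h)\<^sup>2"
  shows "upper_hull C A x \<le> c"
  unfolding upper_hull_def
proof (rule cInf_lower)
  show "bdd_below {c. \<exists>p. \<forall>h. A (x + h) \<le> c + p \<bullet> h + C * (norm h)\<^sup>2}"
    by (rule bdd_belowI[of _ "A x"]) (auto dest: spec[of _ 0])
  show "c \<in> {c. \<exists>p. \<forall>h. A (x + h) \<le> c + p \<bullet> h + C * (norm h)\<^sup>2}"
    by (intro CollectI exI[of _ p] allI assms)
qed

text \<open>Slopes of nearly optimal paraboloids stay bounded: against a steep slope, one unit step
  would take the paraboloid below the minimum of \<open>A\<close> on the unit ball around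
  \<open>x\<close>. A limit of slopes is then optimal.\<close>

lemma upper_hull_attained:
  obtains p where "\<And>h. A (x + h) \<le> upper_hull C A x + p \<bullet> h + C * (norm h)\<^sup>2"
proof -
  let ?S = "{c. \<exists>p. \<forall>h. A (x + h) \<le> c + p \<bullet> h + C * (norm h)\<^sup>2}"
  let ?H = "upper_hull C A x"
  have "A (x + h) \<le> M + 0 \<bullet> h + C * (norm h)\<^sup>2" for h
    using above[of "x + h"] C by (simp add: add_increasing2)
  then have ne: "?S \<noteq> {}" by blast
  have "\<exists>c\<in>?S. c < ?H + 1 / Suc n" for n
    using ne unfolding upper_hull_def by (intro cInf_lessD) auto
  then have "\<forall>n. \<exists>c p. c < ?H + 1 / Suc n \<and> (\<forall>h. A (x + h) \<le> c + p \<bullet> h + C * (norm h)\<^sup>2)"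
    by blast
  from choice[OF this] obtain c where
    "\<forall>n. \<exists>p. c n < ?H + 1 / Suc n \<and> (\<forall>h. A (x + h) \<le> c n + p \<bullet> h + C * (norm h)\<^sup>2)" by blast
  from choice[OF this] obtain p where cp: "\<And>n. c n < ?H + 1 / Suc n"
      "\<And>n h. A (x + h) \<le> c n + p n \<bullet> h + C * (norm h)\<^sup>2" by blast
  have c_lower: "?H \<le> c n" for n
    by (rule upper_hull_le) (rule cp(2))
  have "(\<lambda>n. c n - ?H) \<longlonglongrightarrow> 0"
  proof (rule real_tendsto_sandwich[OF _ _ tendsto_const LIMSEQ_inverse_real_of_nat])
    show "\<forall>\<^sub>F n in sequentially. c n - ?H \<le> inverse (real (Suc n))"
    proof (intro always_eventually allI)
      fix n show "c n - ?H \<le> inverse (real (Suc n))"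
        using cp(1)[of n] unfolding inverse_eq_divide by linarith
    qed
  qed (use c_lower in auto)
  then have c_lim: "c \<longlonglongrightarrow> ?H" by (simp add: LIM_zero_iff)
  have "continuous_on (cball x 1) A" using cont continuous_on_subset by blast
  then obtain y where "\<forall>z\<in>cball x 1. A y \<le> A z"
    using continuous_attains_inf[of "cball x 1" A] by auto
  then obtain m where m: "\<And>y. y \<in> cball x 1 \<Longrightarrow> m \<le> A y" by blast
  have "norm (p n) \<le> ?H + 1 + C - m" for n
  proof (cases "p n = 0")
    case True
    have "m \<le> A x" using m by simp
    with upper_hull_lower[of x] C show ?thesis using True by simp
  next
    case False
    define h where "h = - (1 / norm (p n)) *\<^sub>R p n"
    have h: "norm h = 1" "p n \<bullet> h = - norm (p n)"
      using False by (auto simp: h_def dot_square_norm power2_eq_square)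
    have "m \<le> A (x + h)" using h by (intro m) (simp add: dist_norm)
    also have "\<dots> \<le> c n - norm (p n) + C" using cp(2)[of h n] h by simp
    finally have "norm (p n) \<le> c n + C - m" by simp
    moreover have "1 / real (Suc n) \<le> 1" by simp
    ultimately show ?thesis using cp(1)[of n] by linarith
  qed
  then have "bounded (range p)" by (auto simp: bounded_iff)
  then obtain q \<sigma> where q: "strict_mono (\<sigma> :: nat \<Rightarrow> nat)" "(p \<circ> \<sigma>) \<longlonglongrightarrow> q"
    using bounded_imp_convergent_subsequence[of p] by blast
  have "A (x + h) \<le> ?H + q \<bullet> h + C * (norm h)\<^sup>2" for h
  proof (rule tendsto_lowerbound)
    show "(\<lambda>n. (c \<circ> \<sigma>) n + (p \<circ> \<sigma>) n \<bullet> h + C * (norm h)\<^sup>2) \<longlonglongrightarrow> ?H + q \<bullet> h + C * (norm h)\<^sup>2"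
      by (intro tendsto_intros q LIMSEQ_subseq_LIMSEQ[OF c_lim q(1)])
    show "\<forall>\<^sub>F n in sequentially. A (x + h) \<le> (c \<circ> \<sigma>) n + (p \<circ> \<sigma>) n \<bullet> h + C * (norm h)\<^sup>2"
      using cp(2)[of h] by (simp only: o_def eventually_True simp_thms)
  qed simp
  then show thesis by (rule that)
qed

text \<open>The average of the optimal paraboloids at \<open>x + h\<close> and \<open>x - h\<close>,
  raised by the semiconvexity error of \<open>A\<close>, has the same opening and competes in the
  infimum at \<open>x\<close>.\<close>

lemma semiconvex_upper_hull: "semiconvex k (upper_hull C A)"
  unfolding semiconvex_def
proof (intro allI)
  fix x h
  obtain p where p: "\<And>u. A ((x + h) + u) \<le> upper_hull C A (x + h) + p \<bullet> u + C * (norm u)\<^sup>2"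
    using upper_hull_attained by blast
  obtain q where q: "\<And>u. A ((x - h) + u) \<le> upper_hull C A (x - h) + q \<bullet> u + C * (norm u)\<^sup>2"
    using upper_hull_attained by blast
  have "upper_hull C A x \<le> (upper_hull C A (x + h) + upper_hull C A (x - h)) / 2 + k / 2 * (norm h)\<^sup>2"
  proof (rule upper_hull_le[where p = "(1/2) *\<^sub>R (p + q)"])
    fix u
    have "2 * A (x + u) \<le> A (x + u + h) + A (x + u - h) + k * (norm h)\<^sup>2"
      using sc unfolding semiconvex_def by blast
    moreover have "A (x + u + h) \<le> upper_hull C A (x + h) + p \<bullet> u + C * (norm u)\<^sup>2"
      using p[of u] by (simp add: ac_simps)
    moreover have "A (x + u - h) \<le> upper_hull C A (x - h) + q \<bullet> u + C * (norm u)\<^sup>2"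
      using q[of u] by (simp add: algebra_simps)
    ultimately show "A (x + u) \<le> (upper_hull C A (x + h) + upper_hull C A (x - h)) / 2 + k / 2 * (norm h)\<^sup>2
      + (1/2) *\<^sub>R (p + q) \<bullet> u + C * (norm u)\<^sup>2"
      by (simp add: inner_simps field_simps)
  qed
  then show "2 * upper_hull C A x \<le> upper_hull C A (x + h) + upper_hull C A (x - h) + k * (norm h)\<^sup>2"
    by (simp add: field_simps)
qed

text \<open>An optimal paraboloid at \<open>x\<close>, recentred at \<open>x + h\<close>, keeps its
  opening and competes there, which bounds the hull from above. This bound at \<open>- h\<close>
  together with semiconvexity gives the bound from below.\<close>

lemma upper_hull_expansion:
  obtains p where "quadratic_expansion (C + k) (upper_hull C A) p"
proof -
  let ?H = "upper_hull C A"
  have "\<exists>p. \<forall>h. \<bar>?H (x + h) - ?H x - p \<bullet> h\<bar> \<le> (C + k) * (norm h)\<^sup>2" for x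
  proof -
    obtain p where p: "\<And>u. A (x + u) \<le> ?H x + p \<bullet> u + C * (norm u)\<^sup>2"
      using upper_hull_attained by blast
    have up: "?H (x + h) \<le> ?H x + p \<bullet> h + C * (norm h)\<^sup>2" for h
    proof (rule upper_hull_le[where p = "p + (2 * C) *\<^sub>R h"])
      fix u
      show "A (x + h + u) \<le> ?H x + p \<bullet> h + C * (norm h)\<^sup>2 + (p + (2 * C) *\<^sub>R h) \<bullet> u + C * (norm u)\<^sup>2"
        using p[of "h + u"]
        by (simp add: power2_norm_eq_inner inner_simps inner_commute algebra_simps)
    qed
    have "\<bar>?H (x + h) - ?H x - p \<bullet> h\<bar> \<le> (C + k) * (norm h)\<^sup>2" for h
    proof -
      have "2 * ?H x \<le> ?H (x + h) + ?H (x - h) + k * (norm h)\<^sup>2"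
        using semiconvex_upper_hull unfolding semiconvex_def by blast
      moreover have "?H (x - h) \<le> ?H x - p \<bullet> h + C * (norm h)\<^sup>2" using up[of "- h"] by simp
      moreover have "0 \<le> k * (norm h)\<^sup>2" using k by simp
      ultimately show ?thesis
        using up[of h] unfolding distrib_right by linarith
    qed
    then show ?thesis by blast
  qed
  then obtain p where "\<And>x h. \<bar>?H (x + h) - ?H x - p x \<bullet> h\<bar> \<le> (C + k) * (norm h)\<^sup>2"
    by metis
  then show thesis by (intro that[of p]) (auto simp: quadratic_expansion_def)
qed

end

text \<open>At a contact point the plane bounds \<open>W\<close> above and semiconvexity bounds it
  below by the plane minus \<open>K\<close> times a squared distance. The step \<open>h\<close> in
  the proof maximises \<open>(p - q) \<bullet> h - K * (norm h)^2\<close>.\<close>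

lemma contact_slope_lipschitz:
  fixes W :: "'a::real_inner \<Rightarrow> real"
  assumes sc: "semiconvex K W" and K: "K > 0"
    and p: "\<And>y. W y \<le> W x + p \<bullet> (y - x)" and q: "\<And>y. W y \<le> W z + q \<bullet> (y - z)"
  shows "norm (p - q) \<le> 2 * K * norm (x - z)"
proof -
  have lower: "W x + p \<bullet> h - K * (norm h)\<^sup>2 \<le> W (x + h)" for h
    using sc[unfolded semiconvex_def, rule_format, of x h] p[of "x - h"] by simp
  have lower': "W z + q \<bullet> h - K * (norm h)\<^sup>2 \<le> W (z + h)" for h
    using sc[unfolded semiconvex_def, rule_format, of z h] q[of "z - h"] by simp
  define h where "h = (1 / (2 * K)) *\<^sub>R (p - q)"
  have "(p - q) \<bullet> h \<le> K * (norm h)\<^sup>2 + K * (norm (x - z))\<^sup>2"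
  proof -
    have "z + (x - z) = x" "q \<bullet> (x + h - z) = q \<bullet> (x - z) + q \<bullet> h"
      by (simp_all add: inner_add_right inner_diff_right)
    then show ?thesis
      using lower[of h] lower'[of "x - z"] q[of "x + h"] unfolding inner_diff_left by simp
  qed
  moreover have "(p - q) \<bullet> h = 2 * ((norm (p - q))\<^sup>2 / (4 * K))"
    by (simp add: h_def power2_norm_eq_inner)
  moreover have "K * (norm h)\<^sup>2 = (norm (p - q))\<^sup>2 / (4 * K)"
    using K by (simp add: h_def power_divide power2_eq_square)
  ultimately have "(norm (p - q))\<^sup>2 / (4 * K) \<le> K * (norm (x - z))\<^sup>2" by linarith
  then have "(norm (p - q))\<^sup>2 \<le> K * (norm (x - z))\<^sup>2 * (4 * K)"
    using K by (simp only: pos_divide_le_eq mult_pos_pos zero_less_numeral)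
  also have "\<dots> = (2 * K * norm (x - z))\<^sup>2" by (simp add: power2_eq_square)
  finally have "(norm (p - q))\<^sup>2 \<le> (2 * K * norm (x - z))\<^sup>2" .
  then show ?thesis by (rule power2_le_imp_le) (use K in simp)
qed

text \<open>The slope is a Lipschitz function on the contact set and takes every value in the ball
  of radius \<open>\<delta>\<close>; a Lipschitz image of a negligible set would be negligible.
  Stating non-negligibility leaves the measurability of the contact set aside.\<close>

lemma contact_set_not_negligible:
  fixes W :: "'a::euclidean_space \<Rightarrow> real"
  assumes sc: "semiconvex K W" and K: "K > 0" and \<delta>: "\<delta> > 0"
    and ex: "\<And>p. norm p < \<delta> \<Longrightarrow> \<exists>z. \<forall>y. W y \<le> W z + p \<bullet> (y - z)"
  shows "\<not> negligible {z. \<exists>p. norm p < \<delta> \<and> (\<forall>y. W y \<le> W z + p \<bullet> (y - z))}" (is "\<not> negligible ?E")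
proof
  assume neg: "negligible ?E"
  have "\<forall>z. \<exists>p. z \<in> ?E \<longrightarrow> (\<forall>y. W y \<le> W z + p \<bullet> (y - z))" by blast
  from choice[OF this] obtain P where P: "\<And>z y. z \<in> ?E \<Longrightarrow> W y \<le> W z + P z \<bullet> (y - z)"
    by blast
  have "negligible (P ` ?E)"
  proof (rule negligible_locally_Lipschitz_image[OF _ neg])
    fix x assume x: "x \<in> ?E"
    have "norm (P y - P x) \<le> 2 * K * norm (y - x)" if "y \<in> ?E" for y
      by (rule contact_slope_lipschitz[OF sc K P[OF that] P[OF x]])
    then show "\<exists>T B. open T \<and> x \<in> T \<and> (\<forall>y\<in>?E \<inter> T. norm (P y - P x) \<le> B * norm (y - x))"
      by (intro exI[of _ UNIV] exI[of _ "2 * K"]) blast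
  qed simp
  moreover have "ball 0 \<delta> \<subseteq> P ` ?E"
  proof
    fix p :: 'a assume "p \<in> ball 0 \<delta>"
    then obtain z where z: "\<And>y. W y \<le> W z + p \<bullet> (y - z)" and "norm p < \<delta>" using ex by auto
    then have "z \<in> ?E" by blast
    moreover have "norm (p - P z) \<le> 2 * K * norm (z - z)"
      by (rule contact_slope_lipschitz[OF sc K z P[OF \<open>z \<in> ?E\<close>]])
    then have "p = P z" by simp
    ultimately show "p \<in> P ` ?E" by (rule rev_image_eqI)
  qed
  ultimately have "negligible (ball (0::'a) \<delta>)" by (rule negligible_subset)
  then show False using open_not_negligible[of "ball (0::'a) \<delta>"] \<delta> by simp
qed

section \<open>The theorem on sums\<close>

text \<open>The maximum over the ball of radius \<open>\<rho>\<close> of \<open>A\<close> minus a slightly steeper paraboloid is attained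
  in its interior.\<close>

lemma touching_paraboloid_from_scale:
  fixes A :: "'a::euclidean_space \<Rightarrow> real"
  assumes cont: "continuous_on UNIV A" and X: "linear X" "\<And>h k. X h \<bullet> k = h \<bullet> X k"
    and \<rho>: "\<rho> > 0" and \<epsilon>: "\<epsilon> > 0"
    and le: "\<And>h. norm h \<le> \<rho> \<Longrightarrow> A (x + h) \<le> A x + p \<bullet> h + (X h \<bullet> h) / 2 + \<epsilon> * \<rho>\<^sup>2"
  obtains y q where "norm (y - x) < \<rho>"
    "\<exists>r>0. \<forall>h. norm h < r \<longrightarrow> A (y + h) \<le> A y + q \<bullet> h + ((X h + (4 * \<epsilon>) *\<^sub>R h) \<bullet> h) / 2"
proof -
  \<comment> \<open>On the sphere of radius \<open>\<rho>\<close> the extra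
    \<open>2 * \<epsilon> * (h \<bullet> h)\<close> is twice the permitted error, so no maximum can
    lie there. It adds \<open>4 * \<epsilon>\<close> to the Hessian.\<close>
  define \<psi> where "\<psi> h = p \<bullet> h + (X h \<bullet> h) / 2 + 2 * \<epsilon> * (h \<bullet> h)" for h
  have contX: "continuous_on UNIV X" using X(1) by (simp add: linear_continuous_on linear_linear)
  have "continuous_on (cball 0 \<rho>) (\<lambda>h. A (x + h) - \<psi> h)"
    unfolding \<psi>_def
    by (intro continuous_intros continuous_on_compose2[OF cont] continuous_on_subset[OF contX]) auto
  then obtain h0 where h0: "h0 \<in> cball 0 \<rho>" "\<And>h. h \<in> cball 0 \<rho> \<Longrightarrow> A (x + h) - \<psi> h \<le> A (x + h0) - \<psi> h0"
    using continuous_attains_sup[of "cball 0 \<rho>" "\<lambda>h. A (x + h) - \<psi> h"] \<rho> by auto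
  have "norm h0 \<noteq> \<rho>"
  proof
    assume *: "norm h0 = \<rho>"
    have "\<psi> 0 = 0" using linear_0[OF X(1)] by (simp add: \<psi>_def)
    then have "A x \<le> A (x + h0) - \<psi> h0" using h0(2)[of 0] \<rho> by simp
    also have "\<dots> \<le> A x - \<epsilon> * \<rho>\<^sup>2"
      using le[of h0] * by (simp add: \<psi>_def dot_square_norm)
    finally show False using \<epsilon> \<rho> by (simp add: mult_le_0_iff)
  qed
  then have h0': "norm h0 < \<rho>" using h0(1) by simp
  show thesis
  proof (rule that[of "x + h0" "p + X h0 + (4 * \<epsilon>) *\<^sub>R h0"])
    show "\<exists>r>0. \<forall>h. norm h < r \<longrightarrow> A (x + h0 + h) \<le> A (x + h0) + (p + X h0 + (4 * \<epsilon>) *\<^sub>R h0) \<bullet> h + ((X h + (4 * \<epsilon>) *\<^sub>R h) \<bullet> h) / 2"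
    proof (intro exI[of _ "\<rho> - norm h0"] conjI allI impI)
      fix h :: 'a assume "norm h < \<rho> - norm h0"
      then have "h0 + h \<in> cball 0 \<rho>" using norm_triangle_ineq[of h0 h] by simp
      from h0(2)[OF this] have "A (x + h0 + h) \<le> A (x + h0) + (\<psi> (h0 + h) - \<psi> h0)" by (simp add: add.assoc)
      moreover have "\<psi> (h0 + h) - \<psi> h0 = (p + X h0 + (4 * \<epsilon>) *\<^sub>R h0) \<bullet> h + ((X h + (4 * \<epsilon>) *\<^sub>R h) \<bullet> h) / 2"
        using X(2)[of h h0] by (simp add: \<psi>_def linear_add[OF X(1)] inner_simps inner_commute field_simps)
      ultimately show "A (x + h0 + h) \<le> A (x + h0) + (p + X h0 + (4 * \<epsilon>) *\<^sub>R h0) \<bullet> h + ((X h + (4 * \<epsilon>) *\<^sub>R h) \<bullet> h) / 2"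
        by linarith
    qed (use h0' in simp)
  qed (use h0' in simp)
qed

text \<open>Mean value theorem on the segment to \<open>x + h\<close>: a gradient error
  \<open>\<epsilon> * \<rho>\<close> over a length of at most \<open>\<rho>\<close>. The bound is
  tied to the one scale \<open>\<rho>\<close> and does not improve for shorter
  \<open>h\<close>.\<close>

lemma second_order_from_gradient:
  fixes H :: "'a::euclidean_space \<Rightarrow> real"
  assumes der: "\<And>x. (H has_derivative (\<lambda>h. p x \<bullet> h)) (at x)" and M: "linear M"
    and le: "\<And>h. norm h \<le> \<rho> \<Longrightarrow> norm (p (x + h) - p x - M h) \<le> \<epsilon> * \<rho>" and h: "norm h \<le> \<rho>"
  shows "\<bar>H (x + h) - H x - p x \<bullet> h - (M h \<bullet> h) / 2\<bar> \<le> \<epsilon> * \<rho>\<^sup>2"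
proof -
  define g where "g s = H (x + s *\<^sub>R h) - s * (p x \<bullet> h) - s\<^sup>2 * ((M h \<bullet> h) / 2)" for s
  have "(g has_real_derivative (p (x + s *\<^sub>R h) - p x - M (s *\<^sub>R h)) \<bullet> h) (at s)" for s
  proof -
    have "((\<lambda>s. x + s *\<^sub>R h) has_derivative (\<lambda>t. t *\<^sub>R h)) (at s)"
      by (auto intro!: derivative_eq_intros)
    from has_derivative_compose[OF this der]
    have "((\<lambda>s. H (x + s *\<^sub>R h)) has_real_derivative (p (x + s *\<^sub>R h) \<bullet> h)) (at s)"
      unfolding has_field_derivative_def by (rule has_derivative_eq_rhs) (auto simp: fun_eq_iff)
    then show ?thesis
      unfolding g_def
      by (auto intro!: derivative_eq_intros simp: linear_scale[OF M] inner_simps)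
  qed
  then obtain s where s: "0 < s" "s < 1" "g 1 - g 0 = (p (x + s *\<^sub>R h) - p x - M (s *\<^sub>R h)) \<bullet> h"
    using MVT2[of 0 1 g "\<lambda>s. (p (x + s *\<^sub>R h) - p x - M (s *\<^sub>R h)) \<bullet> h"] by auto
  have "0 \<le> norm h" by simp
  then have \<rho>: "0 \<le> \<rho>" using h by linarith
  have "norm (s *\<^sub>R h) \<le> \<rho>" using s h mult_left_le_one_le[of "norm h" s] by simp
  then have "norm (p (x + s *\<^sub>R h) - p x - M (s *\<^sub>R h)) * norm h \<le> (\<epsilon> * \<rho>) * \<rho>"
    using le[of "s *\<^sub>R h"] h by (intro mult_mono) (auto intro: order_trans[OF norm_ge_zero])
  then have "\<bar>g 1 - g 0\<bar> \<le> \<epsilon> * \<rho>\<^sup>2"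
    unfolding s(3) using Cauchy_Schwarz_ineq2 by (metis mult.assoc order_trans power2_eq_square)
  then show ?thesis by (simp add: g_def)
qed

text \<open>Confines the maximisers of all tilted functions to one ball: beyond radius
  \<open>2 / \<kappa>\<close> the quadratic decay is at least \<open>2 * norm z\<close>, while the
  tilt costs at most \<open>norm z\<close>.\<close>

lemma coercive_perturbation:
  fixes W :: "'a::euclidean_space \<Rightarrow> real"
  assumes \<kappa>: "\<kappa> > 0" and W: "\<And>z. W z \<le> C - \<kappa> * (norm z)\<^sup>2"
  obtains R where "R > 0" "\<And>z p. norm p \<le> 1 \<Longrightarrow> W 0 \<le> W z - p \<bullet> z \<Longrightarrow> norm z < R"
proof
  define R where "R = max (2 / \<kappa>) (\<bar>C - W 0\<bar> + 1)"
  show "R > 0" using \<kappa> by (simp add: R_def)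
  fix z p :: 'a assume p: "norm p \<le> 1" and le: "W 0 \<le> W z - p \<bullet> z"
  have "- (p \<bullet> z) \<le> norm z"
    using Cauchy_Schwarz_ineq2[of p z] mult_right_mono[OF p, of "norm z"] by simp
  then have bd: "\<kappa> * (norm z)\<^sup>2 - norm z \<le> C - W 0" using W[of z] le by linarith
  show "norm z < R"
  proof (rule ccontr)
    assume "\<not> norm z < R"
    then have z: "2 / \<kappa> \<le> norm z" "\<bar>C - W 0\<bar> + 1 \<le> norm z" by (auto simp: R_def)
    then have "2 \<le> \<kappa> * norm z" using \<kappa> by (simp add: field_simps)
    then have "2 * norm z \<le> \<kappa> * norm z * norm z" by (rule mult_right_mono) simp
    then show False using bd z(2) by (simp add: power2_eq_square)
  qed
qed

text \<open>The linear part found at one scale of a gradient field is not known to be symmetric, but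
  only its quadratic form enters the second-order expansion.\<close>

lemma symmetrize_linear:
  fixes M :: "'a::euclidean_space \<Rightarrow> 'a"
  assumes "linear M"
  obtains X where "linear X" "\<And>h k. X h \<bullet> k = h \<bullet> X k" "\<And>h. X h \<bullet> h = M h \<bullet> h"
proof
  let ?X = "\<lambda>h. (1/2) *\<^sub>R (M h + adjoint M h)"
  show "linear ?X" using assms adjoint_linear[OF assms]
    by (intro linear_compose_scale_right linear_compose_add)
  show "?X h \<bullet> k = h \<bullet> ?X k" for h k
    using adjoint_clauses[OF assms] by (simp add: inner_simps inner_commute)
  show "?X h \<bullet> h = M h \<bullet> h" for h
    using adjoint_clauses[OF assms] by (simp add: inner_simps inner_commute)
qed

text \<open>The points returned need not be a maximum of the doubled function; they only do as well
  as \<open>(a, b)\<close> up to \<open>\<eta>\<close>. The slopes \<open>p\<close> and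
  \<open>q\<close> are left unrelated, as the equation does not see gradients.\<close>

theorem approximate_theorem_on_sums:
  fixes A B :: "'a::euclidean_space \<Rightarrow> real"
  assumes A: "semiconvex k A" "continuous_on UNIV A" "\<And>x. A x \<le> c - \<kappa> * (norm x)\<^sup>2"
    and B: "semiconvex k B" "continuous_on UNIV B" "\<And>x. B x \<le> c - \<kappa> * (norm x)\<^sup>2"
    and k: "k > 0" and \<kappa>: "\<kappa> > 0" and \<alpha>: "\<alpha> > 0" and \<eta>: "\<eta> > 0"
  obtains x y p q X Z where
    "A a + B b - \<alpha> / 2 * (norm (a - b))\<^sup>2 - \<eta> \<le> A x + B y - \<alpha> / 2 * (norm (x - y))\<^sup>2"
    "linear X" "\<And>h k. X h \<bullet> k = h \<bullet> X k" "linear Z" "\<And>h k. Z h \<bullet> k = h \<bullet> Z k"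
    "\<And>h k. X h \<bullet> h + Z k \<bullet> k \<le> \<alpha> * (norm (h - k))\<^sup>2 + \<eta> * ((norm h)\<^sup>2 + (norm k)\<^sup>2)"
    "\<exists>r>0. \<forall>h. norm h < r \<longrightarrow> A (x + h) \<le> A x + p \<bullet> h + (X h \<bullet> h) / 2"
    "\<exists>r>0. \<forall>h. norm h < r \<longrightarrow> B (y + h) \<le> B y + q \<bullet> h + (Z h \<bullet> h) / 2"
proof -
  define \<phi> where "\<phi> x y = \<alpha> / 2 * (norm (x - y))\<^sup>2" for x y :: 'a
  define W where "W z = A (fst z) + B (snd z) - \<phi> (fst z) (snd z)" for z
  have \<phi>_expand: "\<phi> (x + h) (y + l) = \<phi> x y + (\<alpha> *\<^sub>R (x - y)) \<bullet> (h - l) + \<alpha> / 2 * (norm (h - l))\<^sup>2" for x y h l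
    by (simp add: \<phi>_def power2_norm_eq_inner inner_simps inner_commute algebra_simps)
  have norm_prod: "(norm (h, l))\<^sup>2 = (norm h)\<^sup>2 + (norm l)\<^sup>2" for h l :: 'a
    by (simp add: norm_Pair)
  have diff_bound: "(norm (h - l))\<^sup>2 \<le> 2 * ((norm h)\<^sup>2 + (norm l)\<^sup>2)" for h l :: 'a
    using inner_ge_zero[of "h + l"] by (simp add: power2_norm_eq_inner inner_simps inner_commute)
  have scW: "semiconvex (k + 2 * \<alpha>) W"
    unfolding semiconvex_def
  proof (intro allI)
    fix z h :: "'a \<times> 'a"
    obtain x y h1 h2 where zh: "z = (x, y)" "h = (h1, h2)" by (metis surj_pair)
    have "2 * A x \<le> A (x + h1) + A (x - h1) + k * (norm h1)\<^sup>2" using A(1) unfolding semiconvex_def by blast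
    moreover have "2 * B y \<le> B (y + h2) + B (y - h2) + k * (norm h2)\<^sup>2" using B(1) unfolding semiconvex_def by blast
    moreover have "\<phi> (x + h1) (y + h2) + \<phi> (x - h1) (y - h2) = 2 * \<phi> x y + \<alpha> * (norm (h1 - h2))\<^sup>2"
      by (simp add: \<phi>_def power2_norm_eq_inner inner_simps inner_commute algebra_simps)
    moreover have "\<alpha> * (norm (h1 - h2))\<^sup>2 \<le> \<alpha> * (2 * ((norm h1)\<^sup>2 + (norm h2)\<^sup>2))"
      using \<alpha> diff_bound by (intro mult_left_mono) auto
    ultimately show "2 * W z \<le> W (z + h) + W (z - h) + (k + 2 * \<alpha>) * (norm h)\<^sup>2"
      by (simp add: W_def zh norm_prod algebra_simps)
  qed
  have contW: "continuous_on UNIV W"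
    unfolding W_def \<phi>_def
    by (intro continuous_intros continuous_on_compose2[OF A(2)] continuous_on_compose2[OF B(2)]) auto
  have Wc: "W z \<le> 2 * c - \<kappa> * (norm z)\<^sup>2" for z
  proof -
    obtain x y where z: "z = (x, y)" by (metis surj_pair)
    have "0 \<le> \<phi> x y" using \<alpha> by (simp add: \<phi>_def)
    then show ?thesis using A(3)[of x] B(3)[of y] by (simp add: W_def z norm_prod algebra_simps)
  qed
  obtain R where R: "R > 0" "\<And>z l. norm l \<le> 1 \<Longrightarrow> W 0 \<le> W z - l \<bullet> z \<Longrightarrow> norm z < R"
    using coercive_perturbation[of \<kappa> W, OF \<kappa> Wc] by blast
  \<comment> \<open>Slopes must not exceed 1 for the confinement to radius \<open>R\<close>, and the
    tilt may lose at most \<open>\<eta> / 2\<close> between \<open>(a, b)\<close> and the contact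
    point.\<close>
  define \<delta> where "\<delta> = min 1 (\<eta> / (2 * (R + norm (a, b))))"
  have Rp: "R + norm (a, b) > 0" using R(1) norm_ge_zero[of "(a, b)"] by linarith
  have \<delta>: "\<delta> > 0" "\<delta> \<le> 1" using Rp \<eta> by (simp_all add: \<delta>_def)
  have "\<delta> \<le> \<eta> / (2 * (R + norm (a, b)))" by (simp add: \<delta>_def)
  then have \<delta>R: "\<delta> * (R + norm (a, b)) \<le> \<eta> / 2"
    using Rp by (simp add: pos_le_divide_eq mult_ac)
  define E where "E = {z. \<exists>l. norm l < \<delta> \<and> (\<forall>y. W y \<le> W z + l \<bullet> (y - z))}"
  have "\<not> negligible E"
    unfolding E_def
  proof (rule contact_set_not_negligible[OF scW _ \<delta>(1)])
    fix l :: "'a \<times> 'a" assume l: "norm l < \<delta>"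
    have "continuous_on (cball 0 R) (\<lambda>z. W z - l \<bullet> z)"
      by (intro continuous_intros continuous_on_subset[OF contW]) auto
    then obtain z where z: "z \<in> cball 0 R" "\<And>y. y \<in> cball 0 R \<Longrightarrow> W y - l \<bullet> y \<le> W z - l \<bullet> z"
      using continuous_attains_sup[of "cball 0 R" "\<lambda>z. W z - l \<bullet> z"] R(1) by auto
    have "W y - l \<bullet> y \<le> W z - l \<bullet> z" for y
    proof (cases "y \<in> cball 0 R")
      case False
      then have "\<not> norm y < R" by simp
      then have "\<not> W 0 \<le> W y - l \<bullet> y" using R(2)[of l y] l \<delta>(2) by auto
      moreover have "W 0 \<le> W z - l \<bullet> z" using z(2)[of 0] R(1) by simp
      ultimately show ?thesis by linarith
    qed (use z in auto)
    then show "\<exists>z. \<forall>y. W y \<le> W z + l \<bullet> (y - z)"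
      by (intro exI[of _ z]) (simp add: inner_diff_right algebra_simps)
  qed (use k \<alpha> in simp)
  \<comment> \<open>The opening \<open>\<alpha> / 2\<close> is that of the penalty in each variable,
    so the contact inequality will survive the replacement of \<open>A\<close> and \<open>B\<close>
    by their hulls.\<close>
  define HA HB where "HA = upper_hull (\<alpha> / 2) A" and "HB = upper_hull (\<alpha> / 2) B"
  have k0: "k \<ge> 0" and \<alpha>2: "\<alpha> / 2 > 0" using k \<alpha> by auto
  have A': "A x \<le> c" for x using A(3)[of x] \<kappa> by (smt (verit) mult_nonneg_nonneg zero_le_power2)
  have B': "B x \<le> c" for x using B(3)[of x] \<kappa> by (smt (verit) mult_nonneg_nonneg zero_le_power2)
  note hullA = A(1) \<alpha>2 k0 A' A(2) and hullB = B(1) \<alpha>2 k0 B' B(2)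
  obtain pA where pA: "quadratic_expansion (\<alpha> / 2 + k) HA pA"
    unfolding HA_def by (rule upper_hull_expansion[OF hullA])
  obtain pB where pB: "quadratic_expansion (\<alpha> / 2 + k) HB pB"
    unfolding HB_def by (rule upper_hull_expansion[OF hullB])
  have HA: "A x \<le> HA x" and HB: "B x \<le> HB x" for x
    unfolding HA_def HB_def using upper_hull_lower[OF hullA] upper_hull_lower[OF hullB] by auto
  define f where "f z = (pA (fst z), pB (snd z))" for z
  define \<Lambda> where "\<Lambda> = 6 * (\<alpha> / 2 + k)"
  have \<Lambda>: "\<Lambda> \<ge> 0" using k \<alpha> by (simp add: \<Lambda>_def)
  have "(2 * \<Lambda>)-lipschitz_on UNIV f"
  proof (rule lipschitz_onI)
    fix z w :: "'a \<times> 'a"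
    have "dist (f z) (f w) \<le> dist (pA (fst z)) (pA (fst w)) + dist (pB (snd z)) (pB (snd w))"
      by (simp add: f_def dist_Pair_Pair sqrt_sum_squares_le_sum)
    also have "\<dots> \<le> \<Lambda> * dist (fst z) (fst w) + \<Lambda> * dist (snd z) (snd w)"
      using quadratic_expansion_lipschitz[OF pA] quadratic_expansion_lipschitz[OF pB] k \<alpha>
      unfolding \<Lambda>_def by (intro add_mono lipschitz_onD[of _ UNIV]) auto
    also have "\<dots> \<le> \<Lambda> * dist z w + \<Lambda> * dist z w"
      using \<Lambda> by (intro add_mono mult_left_mono dist_fst_le dist_snd_le)
    finally show "dist (f z) (f w) \<le> 2 * \<Lambda> * dist z w" by simp
  qed (use \<Lambda> in simp)
  note affine = lipschitz_affine_at_small_scales[OF this]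
  define G where "G z \<longleftrightarrow> (\<forall>\<eta>>0. \<forall>r>0. \<exists>\<rho> M. 0 < \<rho> \<and> \<rho> < r \<and> linear M \<and>
    (\<forall>h. norm h \<le> \<rho> \<longrightarrow> norm (f (z + h) - f z - M h) \<le> \<eta> * \<rho>))" for z
  have "AE z in lborel. G z" unfolding G_def by (rule affine)
  then obtain N where "{z \<in> space lborel. \<not> G z} \<subseteq> N" "emeasure lborel N = 0" "N \<in> sets lborel"
    by (rule AE_E)
  then have N: "N \<in> null_sets lborel" and good: "\<And>z. z \<notin> N \<Longrightarrow> G z"
    by (auto intro: null_setsI)
  have "negligible N" using N by (simp add: negligible_iff_null_sets null_sets_completionI)
  then have "\<not> E \<subseteq> N" using \<open>\<not> negligible E\<close> negligible_subset by blast
  then obtain z0 where z0: "z0 \<in> E" "z0 \<notin> N" by blast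
  obtain x0 y0 where xy0: "z0 = (x0, y0)" by (metis surj_pair)
  obtain l where l: "norm l < \<delta>" "\<And>z. W z \<le> W z0 + l \<bullet> (z - z0)"
    using z0(1) unfolding E_def by blast
  obtain l1 l2 where l12: "l = (l1, l2)" by (metis surj_pair)
  have "W 0 \<le> W z0 - l \<bullet> z0" using l(2)[of 0] by simp
  then have "norm z0 < R" using R(2)[of l z0] l(1) \<delta>(2) by simp
  have near: "W (a, b) - \<eta> / 2 \<le> W z0"
  proof -
    have "l \<bullet> ((a, b) - z0) \<le> norm l * norm ((a, b) - z0)" by (rule norm_cauchy_schwarz)
    also have "\<dots> \<le> \<delta> * (R + norm (a, b))"
      using l(1) \<delta>(1) \<open>norm z0 < R\<close> norm_triangle_ineq4[of "(a, b)" z0]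
      by (intro mult_mono) auto
    finally show ?thesis using \<delta>R l(2)[of "(a, b)"] by linarith
  qed
  have contact: "A x + B y \<le> \<phi> x y + W z0 + l1 \<bullet> (x - x0) + l2 \<bullet> (y - y0)" for x y
    using l(2)[of "(x, y)"] by (simp add: W_def xy0 l12)
  \<comment> \<open>For fixed \<open>y\<close> the right-hand side minus \<open>B y\<close> is a
    paraboloid in \<open>x\<close> of opening \<open>\<alpha> / 2\<close> lying above
    \<open>A\<close>; it therefore also lies above the hull. The next inequality repeats this in
    \<open>y\<close>.\<close>
  have contact1: "HA x + B y \<le> \<phi> x y + W z0 + l1 \<bullet> (x - x0) + l2 \<bullet> (y - y0)" for x y
  proof -
    have "HA x \<le> \<phi> x y - B y + W z0 + l1 \<bullet> (x - x0) + l2 \<bullet> (y - y0)"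
      unfolding HA_def
    proof (rule upper_hull_le[OF hullA, where p = "\<alpha> *\<^sub>R (x - y) + l1"])
      fix h
      show "A (x + h) \<le> \<phi> x y - B y + W z0 + l1 \<bullet> (x - x0) + l2 \<bullet> (y - y0) + (\<alpha> *\<^sub>R (x - y) + l1) \<bullet> h + \<alpha> / 2 * (norm h)\<^sup>2"
        using contact[of "x + h" y] \<phi>_expand[of x h y 0] by (simp add: inner_simps algebra_simps)
    qed
    then show ?thesis by simp
  qed
  have contact2: "HA x + HB y \<le> \<phi> x y + W z0 + l1 \<bullet> (x - x0) + l2 \<bullet> (y - y0)" for x y
  proof -
    have "HB y \<le> \<phi> x y - HA x + W z0 + l1 \<bullet> (x - x0) + l2 \<bullet> (y - y0)"
      unfolding HB_def
    proof (rule upper_hull_le[OF hullB, where p = "l2 - \<alpha> *\<^sub>R (x - y)"])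
      fix h
      show "B (y + h) \<le> \<phi> x y - HA x + W z0 + l1 \<bullet> (x - x0) + l2 \<bullet> (y - y0) + (l2 - \<alpha> *\<^sub>R (x - y)) \<bullet> h + \<alpha> / 2 * (norm h)\<^sup>2"
        using contact1[of x "y + h"] \<phi>_expand[of x 0 y h] by (simp add: inner_simps algebra_simps)
    qed
    then show ?thesis by simp
  qed
  \<comment> \<open>The hulls dominate \<open>A\<close> and \<open>B\<close> everywhere, so equality
    of the sums at the contact point separates.\<close>
  have "HA x0 + HB y0 \<le> A x0 + B y0" using contact2[of x0 y0] by (simp add: W_def xy0)
  then have eq: "HA x0 = A x0" "HB y0 = B y0" using HA[of x0] HB[of y0] by auto
  \<comment> \<open>The block inequality will lose \<open>4 * \<epsilon>\<close>, and moving to a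
    touching point another \<open>4 * \<epsilon>\<close>.\<close>
  define \<epsilon> where "\<epsilon> = \<eta> / 8"
  have \<epsilon>: "\<epsilon> > 0" using \<eta> by (simp add: \<epsilon>_def)
  have "isCont W z0" using contW by (simp add: continuous_on_eq_continuous_at xy0)
  then obtain r where r: "r > 0" "\<And>z. dist z z0 < r \<Longrightarrow> dist (W z) (W z0) < \<eta> / 2"
    using \<eta> unfolding continuous_at_eps_delta by (metis half_gt_zero)
  \<comment> \<open>Each touching point moves by less than \<open>\<rho>\<close>, so the pair stays
    within \<open>r\<close> of \<open>z0\<close>, where \<open>W\<close> changes by less than
    \<open>\<eta> / 2\<close>.\<close>
  obtain \<rho> M where \<rho>: "0 < \<rho>" "\<rho> < r / 2" and M: "linear M"
    and fM: "\<And>h. norm h \<le> \<rho> \<Longrightarrow> norm (f (z0 + h) - f z0 - M h) \<le> \<epsilon> * \<rho>"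
    using good[OF z0(2), unfolded G_def, rule_format, OF \<epsilon> half_gt_zero[OF r(1)]] by blast
  define MA where "MA h = fst (M (h, 0))" for h
  define MB where "MB h = snd (M (0, h))" for h
  have "linear (\<lambda>h. (h, 0 :: 'a) :: 'a \<times> 'a)" "linear (\<lambda>h. (0 :: 'a, h) :: 'a \<times> 'a)"
    by (auto intro!: linearI)
  then have MAB: "linear MA" "linear MB"
    unfolding MA_def MB_def
    using linear_compose[OF linear_compose[OF _ M] linear_fst] linear_compose[OF linear_compose[OF _ M] linear_snd]
    by (auto simp: o_def)
  have fst_snd_le: "norm (fst u) \<le> norm u" "norm (snd u) \<le> norm u" for u :: "'a \<times> 'a"
    by (metis norm_fst_le prod.collapse) (metis norm_snd_le prod.collapse)
  have expA: "\<bar>HA (x0 + h) - HA x0 - pA x0 \<bullet> h - (MA h \<bullet> h) / 2\<bar> \<le> \<epsilon> * \<rho>\<^sup>2" if "norm h \<le> \<rho>" for h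
  proof (rule second_order_from_gradient[OF quadratic_expansion_derivative[OF pA] MAB(1) _ that])
    fix h :: 'a assume "norm h \<le> \<rho>"
    then have "norm (fst (f (z0 + (h, 0)) - f z0 - M (h, 0))) \<le> \<epsilon> * \<rho>"
      by (intro order_trans[OF fst_snd_le(1) fM]) (simp add: norm_Pair)
    then show "norm (pA (x0 + h) - pA x0 - MA h) \<le> \<epsilon> * \<rho>" by (simp add: f_def xy0 MA_def)
  qed
  have expB: "\<bar>HB (y0 + h) - HB y0 - pB y0 \<bullet> h - (MB h \<bullet> h) / 2\<bar> \<le> \<epsilon> * \<rho>\<^sup>2" if "norm h \<le> \<rho>" for h
  proof (rule second_order_from_gradient[OF quadratic_expansion_derivative[OF pB] MAB(2) _ that])
    fix h :: 'a assume "norm h \<le> \<rho>"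
    then have "norm (snd (f (z0 + (0, h)) - f z0 - M (0, h))) \<le> \<epsilon> * \<rho>"
      by (intro order_trans[OF fst_snd_le(2) fM]) (simp add: norm_Pair)
    then show "norm (pB (y0 + h) - pB y0 - MB h) \<le> \<epsilon> * \<rho>" by (simp add: f_def xy0 MB_def)
  qed
  obtain XA where XA: "linear XA" "\<And>h k. XA h \<bullet> k = h \<bullet> XA k" "\<And>h. XA h \<bullet> h = MA h \<bullet> h"
    using symmetrize_linear[OF MAB(1)] by blast
  obtain XB where XB: "linear XB" "\<And>h k. XB h \<bullet> k = h \<bullet> XB k" "\<And>h. XB h \<bullet> h = MB h \<bullet> h"
    using symmetrize_linear[OF MAB(2)] by blast
  \<comment> \<open>Adding the contact inequalities at \<open>(h, j)\<close> and
    \<open>(- h, - j)\<close> cancels slopes and tilts. Four expansions are used, each with error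
    \<open>\<epsilon> * \<rho>^2\<close>.\<close>
  have small: "XA h \<bullet> h + XB j \<bullet> j \<le> \<alpha> * (norm (h - j))\<^sup>2 + 4 * \<epsilon> * \<rho>\<^sup>2" if "norm h \<le> \<rho>" "norm j \<le> \<rho>" for h j
  proof -
    have neg: "XA (- h) \<bullet> (- h) = XA h \<bullet> h" "XB (- j) \<bullet> (- j) = XB j \<bullet> j"
      using linear_neg[OF XA(1), of h] linear_neg[OF XB(1), of j] by simp_all
    have 1: "\<bar>HA (x0 + h) - HA x0 - pA x0 \<bullet> h - (XA h \<bullet> h) / 2\<bar> \<le> \<epsilon> * \<rho>\<^sup>2"
      "\<bar>HA (x0 + - h) - HA x0 - pA x0 \<bullet> (- h) - (XA h \<bullet> h) / 2\<bar> \<le> \<epsilon> * \<rho>\<^sup>2"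
      using expA[of h, folded XA(3)] expA[of "- h", folded XA(3), unfolded neg(1)] that by simp_all
    have 2: "\<bar>HB (y0 + j) - HB y0 - pB y0 \<bullet> j - (XB j \<bullet> j) / 2\<bar> \<le> \<epsilon> * \<rho>\<^sup>2"
      "\<bar>HB (y0 + - j) - HB y0 - pB y0 \<bullet> (- j) - (XB j \<bullet> j) / 2\<bar> \<le> \<epsilon> * \<rho>\<^sup>2"
      using expB[of j, folded XB(3)] expB[of "- j", folded XB(3), unfolded neg(2)] that by simp_all
    have 3: "\<phi> (x0 + h) (y0 + j) + \<phi> (x0 + - h) (y0 + - j) = 2 * \<phi> x0 y0 + \<alpha> * (norm (h - j))\<^sup>2"
      unfolding \<phi>_expand by (simp add: inner_simps norm_minus_commute)
    have 4: "HA (x0 + h) + HB (y0 + j) \<le> \<phi> (x0 + h) (y0 + j) + W z0 + l1 \<bullet> h + l2 \<bullet> j"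
      "HA (x0 + - h) + HB (y0 + - j) \<le> \<phi> (x0 + - h) (y0 + - j) + W z0 - l1 \<bullet> h - l2 \<bullet> j"
      using contact2[of "x0 + h" "y0 + j"] contact2[of "x0 + - h" "y0 + - j"] by simp_all
    have 5: "W z0 = HA x0 + HB y0 - \<phi> x0 y0" by (simp add: W_def xy0 eq)
    have 6: "pA x0 \<bullet> (- h) = - (pA x0 \<bullet> h)" "pB y0 \<bullet> (- j) = - (pB y0 \<bullet> j)" by simp_all
    show ?thesis using 1 2 3 4 5 unfolding 6 abs_le_iff by linarith
  qed
  \<comment> \<open>Both sides without the error are homogeneous of degree two. Scaling
    \<open>(h, j)\<close> to norm \<open>\<rho>\<close> turns the additive error into a multiple of
    its squared norm.\<close>
  have block: "XA h \<bullet> h + XB j \<bullet> j \<le> \<alpha> * (norm (h - j))\<^sup>2 + 4 * \<epsilon> * ((norm h)\<^sup>2 + (norm j)\<^sup>2)" for h j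
  proof (cases "(h, j) = 0")
    case True
    then show ?thesis by (simp add: zero_prod_def linear_0[OF XA(1)] linear_0[OF XB(1)])
  next
    case False
    define m where "m = norm (h, j)"
    define s where "s = \<rho> / m"
    have m: "m > 0" using False by (simp add: m_def)
    then have s: "s > 0" "s * m = \<rho>" using \<rho> by (auto simp: s_def)
    have "norm (s *\<^sub>R h) \<le> \<rho>" "norm (s *\<^sub>R j) \<le> \<rho>"
      using s norm_fst_le[of h j] norm_snd_le[of j h] by (auto simp flip: s(2) m_def)
    from small[OF this]
    have "s\<^sup>2 * (XA h \<bullet> h + XB j \<bullet> j) \<le> s\<^sup>2 * (\<alpha> * (norm (h - j))\<^sup>2 + 4 * \<epsilon> * m\<^sup>2)"
      using s(1) by (simp add: linear_scale[OF XA(1)] linear_scale[OF XB(1)] power_mult_distrib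
          power2_eq_square algebra_simps flip: s(2) scaleR_diff_right)
    then show ?thesis using s(1) by (simp add: m_def norm_prod)
  qed
  obtain x p where x: "norm (x - x0) < \<rho>"
    "\<exists>r>0. \<forall>h. norm h < r \<longrightarrow> A (x + h) \<le> A x + p \<bullet> h + ((XA h + (4 * \<epsilon>) *\<^sub>R h) \<bullet> h) / 2"
  proof (rule touching_paraboloid_from_scale[OF A(2) XA(1,2) \<rho>(1) \<epsilon>])
    show "A (x0 + h) \<le> A x0 + pA x0 \<bullet> h + (XA h \<bullet> h) / 2 + \<epsilon> * \<rho>\<^sup>2" if "norm h \<le> \<rho>" for h
      using expA[OF that] HA[of "x0 + h"] eq(1) XA(3)[of h] by linarith
  qed blast
  obtain y q where y: "norm (y - y0) < \<rho>"
    "\<exists>r>0. \<forall>h. norm h < r \<longrightarrow> B (y + h) \<le> B y + q \<bullet> h + ((XB h + (4 * \<epsilon>) *\<^sub>R h) \<bullet> h) / 2"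
  proof (rule touching_paraboloid_from_scale[OF B(2) XB(1,2) \<rho>(1) \<epsilon>])
    show "B (y0 + h) \<le> B y0 + pB y0 \<bullet> h + (XB h \<bullet> h) / 2 + \<epsilon> * \<rho>\<^sup>2" if "norm h \<le> \<rho>" for h
      using expB[OF that] HB[of "y0 + h"] eq(2) XB(3)[of h] by linarith
  qed blast
  have "dist (x, y) z0 \<le> norm (x - x0) + norm (y - y0)"
    by (simp add: xy0 dist_norm norm_Pair_le)
  then have "dist (W (x, y)) (W z0) < \<eta> / 2" using x(1) y(1) \<rho>(2) by (intro r(2)) linarith
  then have Wxy: "W (a, b) - \<eta> \<le> W (x, y)" using near unfolding dist_real_def abs_less_iff by linarith
  show thesis
  proof (rule that[OF _ _ _ _ _ _ x(2) y(2)])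
    show "A a + B b - \<alpha> / 2 * (norm (a - b))\<^sup>2 - \<eta> \<le> A x + B y - \<alpha> / 2 * (norm (x - y))\<^sup>2"
      using Wxy by (simp add: W_def \<phi>_def)
    show "linear (\<lambda>h. XA h + (4 * \<epsilon>) *\<^sub>R h)" "linear (\<lambda>h. XB h + (4 * \<epsilon>) *\<^sub>R h)"
      by (intro linear_compose_add XA(1) XB(1) linear_scale_self)+
    show "(XA h + (4 * \<epsilon>) *\<^sub>R h) \<bullet> k = h \<bullet> (XA k + (4 * \<epsilon>) *\<^sub>R k)"
      "(XB h + (4 * \<epsilon>) *\<^sub>R h) \<bullet> k = h \<bullet> (XB k + (4 * \<epsilon>) *\<^sub>R k)" for h k
      using XA(2)[of h k] XB(2)[of h k] by (simp_all add: inner_simps)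
    show "(XA h + (4 * \<epsilon>) *\<^sub>R h) \<bullet> h + (XB k + (4 * \<epsilon>) *\<^sub>R k) \<bullet> k
       \<le> \<alpha> * (norm (h - k))\<^sup>2 + \<eta> * ((norm h)\<^sup>2 + (norm k)\<^sup>2)" for h k
      using block[of h k] by (simp add: inner_simps \<epsilon>_def power2_norm_eq_inner algebra_simps)
  qed
qed

section \<open>Upper semicontinuous functions on compact sets\<close>

lemma usc_on_add:
  assumes "usc_on S v" "usc_on S w"
  shows "usc_on S (\<lambda>x. v x + w x)"
  unfolding usc_on_def
proof (intro ballI allI impI)
  fix x c assume x: "x \<in> S" and lt: "v x + w x < c"
  define e where "e = (c - (v x + w x)) / 2"
  have e: "e > 0" using lt by (simp add: e_def)
  have "\<forall>\<^sub>F y in at x within S. v y < v x + e" "\<forall>\<^sub>F y in at x within S. w y < w x + e"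
    using assms x e unfolding usc_on_def by simp_all
  then show "\<forall>\<^sub>F y in at x within S. v y + w y < c"
    by eventually_elim (simp add: e_def field_simps)
qed

lemma usc_on_continuous:
  assumes "continuous_on S (g :: 'a::topological_space \<Rightarrow> real)"
  shows "usc_on S g"
  using assms unfolding usc_on_def continuous_on_def by (auto intro: order_tendstoD)

lemma usc_on_uminus:
  assumes "lsc_on S u"
  shows "usc_on S (\<lambda>x. - u x)"
  unfolding usc_on_def
proof (intro ballI allI impI)
  fix x c assume "x \<in> S" "- u x < c"
  then have "\<forall>\<^sub>F y in at x within S. - c < u y"
    using assms unfolding lsc_on_def by (simp add: minus_less_iff)
  then show "\<forall>\<^sub>F y in at x within S. - u y < c"
    by eventually_elim simp
qed

lemma usc_on_open_less:
  assumes "usc_on S v" "x \<in> S" "v x < c"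
  obtains U where "open U" "x \<in> U" "\<And>y. y \<in> U \<Longrightarrow> y \<in> S \<Longrightarrow> v y < c"
proof -
  have "\<forall>\<^sub>F y in at x within S. v y < c" using assms unfolding usc_on_def by blast
  then obtain U where "open U" "x \<in> U" "\<forall>y\<in>U. y \<noteq> x \<longrightarrow> y \<in> S \<longrightarrow> v y < c"
    unfolding eventually_at_topological by blast
  with assms(3) show thesis by (intro that[of U]) auto
qed

text \<open>Without a maximum each \<open>x\<close> is beaten by some \<open>m x\<close>, which by
  semicontinuity beats a whole neighbourhood of \<open>x\<close>. In a finite subcover the best of
  these values would have to be beaten by another of them.\<close>

lemma usc_on_attains_max:
  assumes "compact S" "S \<noteq> {}" "usc_on S v"
  obtains x where "x \<in> S" "\<And>y. y \<in> S \<Longrightarrow> v y \<le> v x"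
proof (rule ccontr)
  assume "\<not> thesis"
  then have no: "\<forall>x. \<exists>y. x \<in> S \<longrightarrow> y \<in> S \<and> v x < v y" using that by (meson not_le)
  from choice[OF this] obtain m where m: "\<And>x. x \<in> S \<Longrightarrow> m x \<in> S \<and> v x < v (m x)" by blast
  have "\<forall>x. \<exists>U. x \<in> S \<longrightarrow> open U \<and> x \<in> U \<and> (\<forall>y. y \<in> U \<longrightarrow> y \<in> S \<longrightarrow> v y < v (m x))"
    using usc_on_open_less[OF assms(3)] m by metis
  from choice[OF this] obtain U where U: "\<And>x. x \<in> S \<Longrightarrow> open (U x) \<and> x \<in> U x"
    "\<And>x y. x \<in> S \<Longrightarrow> y \<in> U x \<Longrightarrow> y \<in> S \<Longrightarrow> v y < v (m x)" by blast
  obtain T where T: "T \<subseteq> S" "finite T" "S \<subseteq> (\<Union>x\<in>T. U x)"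
    using compactE_image[OF assms(1), of S U] U(1) by blast
  then have "T \<noteq> {}" using assms(2) by auto
  then have "Max ((\<lambda>s. v (m s)) ` T) \<in> (\<lambda>s. v (m s)) ` T" using T(2) by (intro Max_in) auto
  then obtain t where t: "t \<in> T" "v (m t) = Max ((\<lambda>s. v (m s)) ` T)" by auto
  have mt: "m t \<in> S" using m t(1) T(1) by blast
  then obtain s where "s \<in> T" "m t \<in> U s" using T(3) by blast
  then have "v (m t) < v (m s)" using U(2) mt T(1) by blast
  moreover have "v (m s) \<le> v (m t)" unfolding t(2) using \<open>s \<in> T\<close> T(2) by (intro Max_ge) auto
  ultimately show False by simp
qed

lemma usc_on_eventually_less:
  assumes "usc_on S v" "x \<in> S" "v x < c" "\<And>n. y n \<in> S" "y \<longlonglongrightarrow> x"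
  shows "\<forall>\<^sub>F n in sequentially. v (y n) < c"
proof -
  obtain U where U: "open U" "x \<in> U" "\<And>y. y \<in> U \<Longrightarrow> y \<in> S \<Longrightarrow> v y < c"
    using usc_on_open_less[OF assms(1-3)] by blast
  show ?thesis using topological_tendstoD[OF assms(5) U(1,2)]
    by eventually_elim (use U(3) assms(4) in auto)
qed

section \<open>Sup-convolutions\<close>

text \<open>The supremum runs over \<open>S\<close> while \<open>x\<close> is arbitrary:
  \<open>v\<close> is controlled only on a compact set, but hulls and contact sets need a function
  on the whole space.\<close>

definition sup_conv :: "real \<Rightarrow> 'a::real_normed_vector set \<Rightarrow> ('a \<Rightarrow> real) \<Rightarrow> 'a \<Rightarrow> real" where
  "sup_conv k S v x = (SUP z\<in>S. v z - k / 2 * (norm (x - z))\<^sup>2)"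

context
  fixes S :: "'a::euclidean_space set" and v :: "'a \<Rightarrow> real" and k :: real
  assumes S: "compact S" "S \<noteq> {}" and v: "usc_on S v" and k: "k > 0"
begin

lemma sup_conv_attained:
  obtains z where "z \<in> S" "sup_conv k S v x = v z - k / 2 * (norm (x - z))\<^sup>2"
    "\<And>y. y \<in> S \<Longrightarrow> v y - k / 2 * (norm (x - y))\<^sup>2 \<le> sup_conv k S v x"
proof -
  have "usc_on S (\<lambda>z. - (k / 2 * (norm (x - z))\<^sup>2))"
    by (intro usc_on_continuous continuous_intros)
  from usc_on_add[OF v this] obtain z where z: "z \<in> S"
    "\<And>y. y \<in> S \<Longrightarrow> v y - k / 2 * (norm (x - y))\<^sup>2 \<le> v z - k / 2 * (norm (x - z))\<^sup>2"
    using usc_on_attains_max[OF S, of "\<lambda>z. v z + - (k / 2 * (norm (x - z))\<^sup>2)"] by auto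
  then have "sup_conv k S v x = v z - k / 2 * (norm (x - z))\<^sup>2"
    unfolding sup_conv_def by (intro cSup_eq_maximum) auto
  with z show thesis by (intro that) auto
qed

lemma sup_conv_ge: "y \<in> S \<Longrightarrow> v y - k / 2 * (norm (x - y))\<^sup>2 \<le> sup_conv k S v x"
  using sup_conv_attained by blast

lemma semiconvex_sup_conv: "semiconvex k (sup_conv k S v)"
  unfolding semiconvex_def
proof (intro allI)
  fix x h
  obtain z where z: "z \<in> S" "sup_conv k S v x = v z - k / 2 * (norm (x - z))\<^sup>2"
    using sup_conv_attained by blast
  have "(norm (x + h - z))\<^sup>2 + (norm (x - h - z))\<^sup>2 = 2 * (norm (x - z))\<^sup>2 + 2 * (norm h)\<^sup>2"
    by (simp add: power2_norm_eq_inner inner_simps inner_commute algebra_simps)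
  then have "k / 2 * ((norm (x + h - z))\<^sup>2 + (norm (x - h - z))\<^sup>2) = k / 2 * (2 * (norm (x - z))\<^sup>2 + 2 * (norm h)\<^sup>2)"
    by simp
  then show "2 * sup_conv k S v x \<le> sup_conv k S v (x + h) + sup_conv k S v (x - h) + k * (norm h)\<^sup>2"
    using sup_conv_ge[OF z(1), of "x + h"] sup_conv_ge[OF z(1), of "x - h"] z(2)
    by (simp add: distrib_left)
qed

text \<open>Adding \<open>k / 2 * (norm x)^2\<close> leaves a supremum of functions affine in
  \<open>x\<close>, hence a finite convex function on the whole space, which is continuous.\<close>

lemma continuous_sup_conv: "continuous_on UNIV (sup_conv k S v)"
proof -
  define g where "g x = sup_conv k S v x + k / 2 * (norm x)\<^sup>2" for x
  have affine: "v z - k / 2 * (norm (x - z))\<^sup>2 + k / 2 * (norm x)\<^sup>2 = (v z - k / 2 * (norm z)\<^sup>2) + k * (x \<bullet> z)" for x z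
    by (simp add: power2_norm_eq_inner inner_simps inner_commute algebra_simps)
  have ge: "(v z - k / 2 * (norm z)\<^sup>2) + k * (x \<bullet> z) \<le> g x" if "z \<in> S" for x z
    using sup_conv_ge[OF that, of x] affine[of z x] by (simp add: g_def)
  have "convex_on UNIV g"
    unfolding convex_on_def
  proof (intro conjI ballI allI impI)
    fix x y :: 'a and s t :: real assume st: "0 \<le> s" "0 \<le> t" "s + t = 1"
    obtain z where z: "z \<in> S" "sup_conv k S v (s *\<^sub>R x + t *\<^sub>R y) = v z - k / 2 * (norm (s *\<^sub>R x + t *\<^sub>R y - z))\<^sup>2"
      using sup_conv_attained by blast
    have "g (s *\<^sub>R x + t *\<^sub>R y) = (s + t) * (v z - k / 2 * (norm z)\<^sup>2) + k * ((s *\<^sub>R x + t *\<^sub>R y) \<bullet> z)"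
      unfolding g_def z(2) affine by (simp add: st)
    also have "\<dots> = s * ((v z - k / 2 * (norm z)\<^sup>2) + k * (x \<bullet> z)) + t * ((v z - k / 2 * (norm z)\<^sup>2) + k * (y \<bullet> z))"
      by (simp add: inner_simps algebra_simps)
    also have "\<dots> \<le> s * g x + t * g y"
      using st ge[OF z(1)] by (intro add_mono mult_left_mono) auto
    finally show "g (s *\<^sub>R x + t *\<^sub>R y) \<le> s * g x + t * g y" .
  qed simp
  then have "continuous_on UNIV g" by (intro convex_on_continuous) auto
  then have "continuous_on UNIV (\<lambda>x. g x - k / 2 * (norm x)\<^sup>2)" by (intro continuous_intros)
  then show ?thesis by (simp add: g_def)
qed

lemma sup_conv_coercive:
  obtains c where "\<And>x. sup_conv k S v x \<le> c - k / 4 * (norm x)\<^sup>2"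
proof -
  obtain m where m: "\<And>y. y \<in> S \<Longrightarrow> v y \<le> v m" using usc_on_attains_max[OF S v] by blast
  obtain R where R: "\<And>y. y \<in> S \<Longrightarrow> norm y \<le> R" using compact_imp_bounded[OF S(1)] by (auto simp: bounded_iff)
  have "sup_conv k S v x \<le> (v m + k / 2 * R\<^sup>2) - k / 4 * (norm x)\<^sup>2" for x
  proof -
    obtain z where z: "z \<in> S" "sup_conv k S v x = v z - k / 2 * (norm (x - z))\<^sup>2"
      using sup_conv_attained by blast
    \<comment> \<open>This square gives \<open>(norm x)^2 / 2 - (norm z)^2\<close> as a lower bound
      for the squared distance, at the cost of half the quadratic decay.\<close>
    have "0 \<le> (norm (x - 2 *\<^sub>R z))\<^sup>2" by simp
    also have "\<dots> = 2 * (norm (x - z))\<^sup>2 + 2 * (norm z)\<^sup>2 - (norm x)\<^sup>2"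
      by (simp add: power2_norm_eq_inner inner_simps inner_commute algebra_simps)
    finally have "(norm x)\<^sup>2 / 2 - (norm z)\<^sup>2 \<le> (norm (x - z))\<^sup>2" by simp
    moreover have "(norm z)\<^sup>2 \<le> R\<^sup>2" using R[OF z(1)] by (intro power_mono) auto
    ultimately have "k / 2 * ((norm x)\<^sup>2 / 2 - R\<^sup>2) \<le> k / 2 * (norm (x - z))\<^sup>2"
      using k by (intro mult_left_mono) auto
    then show ?thesis using z(2) m[OF z(1)] by (simp add: algebra_simps)
  qed
  then show thesis by (rule that)
qed

text \<open>Moving \<open>x\<close> and its maximiser \<open>z\<close> by the same \<open>h\<close>
  leaves the penalty unchanged, so a paraboloid touching the sup-convolution at \<open>x\<close>
  touches \<open>v\<close> at \<open>z\<close> with the same slope and Hessian.\<close>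

lemma sup_conv_touching:
  assumes z: "z \<in> S" "sup_conv k S v x = v z - k / 2 * (norm (x - z))\<^sup>2"
    and le: "sup_conv k S v (x + h) \<le> sup_conv k S v x + c" and h: "z + h \<in> S"
  shows "v (z + h) \<le> v z + c"
  using sup_conv_ge[OF h, of "x + h"] le z(2) by simp

end

lemma symmetric_linear_matrix:
  fixes X :: "real^'n \<Rightarrow> real^'n"
  assumes "linear X" "\<And>h k. X h \<bullet> k = h \<bullet> X k"
  shows "transpose (matrix X) = matrix X"
  using matrix_adjoint[OF assms(1)] adjoint_unique[of X X] assms(2) by simp

text \<open>The sup-convolutions use the same \<open>\<alpha>\<close> as the penalty, so no second
  parameter has to be sent to a limit. The path from \<open>x\<close> to \<open>y\<close> through
  \<open>\<xi>\<close> and \<open>\<zeta>\<close> has three pieces, each squared length weighted by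
  \<open>\<alpha> / 2\<close>; the inequality for the square of a sum of three terms leaves
  \<open>\<alpha> / 6\<close>.\<close>

lemma theorem_on_sums_usc:
  fixes v w :: "real^'n \<Rightarrow> real"
  assumes S: "compact S" "a \<in> S" and v: "usc_on S v" and w: "usc_on S w" and \<alpha>: "\<alpha> > 0" and \<eta>: "\<eta> > 0"
  obtains x y p q and X Z :: "real^'n^'n" where
    "x \<in> S" "y \<in> S" "v a + w a - \<eta> + \<alpha> / 6 * (norm (x - y))\<^sup>2 \<le> v x + w y"
    "transpose X = X" "transpose Z = Z"
    "\<And>h k. (X *v h) \<bullet> h + (Z *v k) \<bullet> k \<le> \<alpha> * (norm (h - k))\<^sup>2 + \<eta> * ((norm h)\<^sup>2 + (norm k)\<^sup>2)"
    "\<exists>r>0. \<forall>h. norm h < r \<longrightarrow> x + h \<in> S \<longrightarrow> v (x + h) \<le> v x + p \<bullet> h + ((X *v h) \<bullet> h) / 2"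
    "\<exists>r>0. \<forall>h. norm h < r \<longrightarrow> y + h \<in> S \<longrightarrow> w (y + h) \<le> w y + q \<bullet> h + ((Z *v h) \<bullet> h) / 2"
proof -
  have ne: "S \<noteq> {}" using S by auto
  define A where "A = sup_conv \<alpha> S v"
  define B where "B = sup_conv \<alpha> S w"
  note v' = S(1) ne v \<alpha> and w' = S(1) ne w \<alpha>
  obtain c1 where c1: "\<And>x. A x \<le> c1 - \<alpha> / 4 * (norm x)\<^sup>2" unfolding A_def using sup_conv_coercive[OF v'] by blast
  obtain c2 where c2: "\<And>x. B x \<le> c2 - \<alpha> / 4 * (norm x)\<^sup>2" unfolding B_def using sup_conv_coercive[OF w'] by blast
  obtain c where c: "c1 \<le> c" "c2 \<le> c" using linear[of c1 c2] by blast
  have A: "semiconvex \<alpha> A" "continuous_on UNIV A" "\<And>x. A x \<le> c - \<alpha> / 4 * (norm x)\<^sup>2"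
    using semiconvex_sup_conv[OF v'] continuous_sup_conv[OF v'] c order_trans[OF c1 diff_right_mono]
    by (auto simp: A_def)
  have B: "semiconvex \<alpha> B" "continuous_on UNIV B" "\<And>x. B x \<le> c - \<alpha> / 4 * (norm x)\<^sup>2"
    using semiconvex_sup_conv[OF w'] continuous_sup_conv[OF w'] c order_trans[OF c2 diff_right_mono]
    by (auto simp: B_def)
  have \<alpha>4: "\<alpha> / 4 > 0" using \<alpha> by simp
  obtain \<xi> \<zeta> p q X Z where
    1: "A a + B a - \<alpha> / 2 * (norm (a - a))\<^sup>2 - \<eta> \<le> A \<xi> + B \<zeta> - \<alpha> / 2 * (norm (\<xi> - \<zeta>))\<^sup>2" and
    X: "linear X" "\<And>h k. X h \<bullet> k = h \<bullet> X k" and Z: "linear Z" "\<And>h k. Z h \<bullet> k = h \<bullet> Z k" and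
    block: "\<And>h k. X h \<bullet> h + Z k \<bullet> k \<le> \<alpha> * (norm (h - k))\<^sup>2 + \<eta> * ((norm h)\<^sup>2 + (norm k)\<^sup>2)" and
    tA: "\<exists>r>0. \<forall>h. norm h < r \<longrightarrow> A (\<xi> + h) \<le> A \<xi> + p \<bullet> h + (X h \<bullet> h) / 2" and
    tB: "\<exists>r>0. \<forall>h. norm h < r \<longrightarrow> B (\<zeta> + h) \<le> B \<zeta> + q \<bullet> h + (Z h \<bullet> h) / 2"
    by (rule approximate_theorem_on_sums[OF A B \<alpha> \<alpha>4 \<alpha> \<eta>, of a a]) blast
  obtain x where x: "x \<in> S" "A \<xi> = v x - \<alpha> / 2 * (norm (\<xi> - x))\<^sup>2"
    unfolding A_def using sup_conv_attained[OF v'] by blast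
  obtain y where y: "y \<in> S" "B \<zeta> = w y - \<alpha> / 2 * (norm (\<zeta> - y))\<^sup>2"
    unfolding B_def using sup_conv_attained[OF w'] by blast
  have mX: "matrix X *v h = X h" and mZ: "matrix Z *v h = Z h" for h
    using X Z by (simp_all add: matrix_works)
  show thesis
  proof (rule that[of x y "matrix X" "matrix Z" p q])
    have "v a \<le> A a" "w a \<le> B a"
      using sup_conv_ge[OF v' S(2), of a] sup_conv_ge[OF w' S(2), of a] by (simp_all add: A_def B_def)
    moreover have "(norm (x - y))\<^sup>2 \<le> 3 * ((norm (\<xi> - x))\<^sup>2 + (norm (\<zeta> - y))\<^sup>2 + (norm (\<xi> - \<zeta>))\<^sup>2)"
    proof -
      have "norm (x - y) \<le> norm (\<xi> - x) + norm (\<zeta> - y) + norm (\<xi> - \<zeta>)"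
        using norm_triangle_ineq4[of "\<zeta> - y" "\<xi> - x"] norm_triangle_ineq[of "(\<zeta> - y) - (\<xi> - x)" "\<xi> - \<zeta>"] by simp
      then have "(norm (x - y))\<^sup>2 \<le> (norm (\<xi> - x) + norm (\<zeta> - y) + norm (\<xi> - \<zeta>))\<^sup>2"
        by (intro power_mono) auto
      also have "\<dots> \<le> 3 * ((norm (\<xi> - x))\<^sup>2 + (norm (\<zeta> - y))\<^sup>2 + (norm (\<xi> - \<zeta>))\<^sup>2)"
        using sum_squares_bound[of "norm (\<xi> - x)" "norm (\<zeta> - y)"] sum_squares_bound[of "norm (\<xi> - x)" "norm (\<xi> - \<zeta>)"]
          sum_squares_bound[of "norm (\<zeta> - y)" "norm (\<xi> - \<zeta>)"]
        by (simp add: power2_eq_square algebra_simps)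
      finally show ?thesis .
    qed
    then have "\<alpha> / 6 * (norm (x - y))\<^sup>2 \<le> \<alpha> / 6 * (3 * ((norm (\<xi> - x))\<^sup>2 + (norm (\<zeta> - y))\<^sup>2 + (norm (\<xi> - \<zeta>))\<^sup>2))"
      using \<alpha> by (intro mult_left_mono) auto
    ultimately show "v a + w a - \<eta> + \<alpha> / 6 * (norm (x - y))\<^sup>2 \<le> v x + w y"
      using 1 x(2) y(2) by (simp add: algebra_simps)
    show "transpose (matrix X) = matrix X" "transpose (matrix Z) = matrix Z"
      using symmetric_linear_matrix[OF X] symmetric_linear_matrix[OF Z] by auto
    show "(matrix X *v h) \<bullet> h + (matrix Z *v k) \<bullet> k \<le> \<alpha> * (norm (h - k))\<^sup>2 + \<eta> * ((norm h)\<^sup>2 + (norm k)\<^sup>2)" for h k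
      unfolding mX mZ by (rule block)
    show "\<exists>r>0. \<forall>h. norm h < r \<longrightarrow> x + h \<in> S \<longrightarrow> v (x + h) \<le> v x + p \<bullet> h + ((matrix X *v h) \<bullet> h) / 2"
      using tA unfolding mX add.assoc A_def using sup_conv_touching[OF v' x[unfolded A_def]] by meson
    show "\<exists>r>0. \<forall>h. norm h < r \<longrightarrow> y + h \<in> S \<longrightarrow> w (y + h) \<le> w y + q \<bullet> h + ((matrix Z *v h) \<bullet> h) / 2"
      using tB unfolding mZ add.assoc B_def using sup_conv_touching[OF w' y[unfolded B_def]] by meson
  qed (use x y in auto)
qed

section \<open>Testing viscosity solutions with touching paraboloids\<close>

text \<open>Accepts the touching condition relative to the closure, as the theorem on sums delivers
  it; at a point of the open set the restriction disappears for small \<open>h\<close>.\<close>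

lemma viscosity_subsolution_touching:
  fixes X :: "real^'n^'n"
  assumes v: "viscosity_subsolution F Om v" and Om: "open Om" "x \<in> Om" and X: "transpose X = X"
    and touch: "\<exists>r>0. \<forall>h. norm h < r \<longrightarrow> x + h \<in> closure Om \<longrightarrow> v (x + h) \<le> v x + p \<bullet> h + ((X *v h) \<bullet> h) / 2"
  shows "0 \<le> F X x"
proof -
  define \<phi> where "\<phi> = (\<lambda>y. v x + p \<bullet> (y - x) + (X *v (y - x)) \<bullet> (y - x) / 2)"
  obtain r where r: "r > 0" "\<And>h. norm h < r \<Longrightarrow> x + h \<in> closure Om \<Longrightarrow> v (x + h) \<le> v x + p \<bullet> h + ((X *v h) \<bullet> h) / 2"
    using touch by blast
  have "\<forall>\<^sub>F y in nhds x. y \<in> Om \<inter> ball x r"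
    using Om r(1) by (intro eventually_nhds_in_open) auto
  then have "\<forall>\<^sub>F y in nhds x. v y \<le> \<phi> y"
  proof eventually_elim
    case (elim y)
    then show ?case using r(2)[of "y - x"] closure_subset[of Om] by (auto simp: \<phi>_def dist_norm norm_minus_commute)
  qed
  moreover have "C2_near \<phi> x" "hessian \<phi> x = X"
    unfolding \<phi>_def using C2_near_quadratic[OF X] hessian_quadratic[OF X] by auto
  moreover have "\<phi> x = v x" by (simp add: \<phi>_def)
  ultimately show ?thesis using v Om(2) unfolding viscosity_subsolution_def by metis
qed

lemma viscosity_supersolution_touching:
  fixes X :: "real^'n^'n"
  assumes u: "viscosity_supersolution F Om u" and Om: "open Om" "x \<in> Om" and X: "transpose X = X"
    and touch: "\<exists>r>0. \<forall>h. norm h < r \<longrightarrow> x + h \<in> closure Om \<longrightarrow> u x + p \<bullet> h + ((X *v h) \<bullet> h) / 2 \<le> u (x + h)"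
  shows "F X x \<le> 0"
proof -
  define \<phi> where "\<phi> = (\<lambda>y. u x + p \<bullet> (y - x) + (X *v (y - x)) \<bullet> (y - x) / 2)"
  obtain r where r: "r > 0" "\<And>h. norm h < r \<Longrightarrow> x + h \<in> closure Om \<Longrightarrow> u x + p \<bullet> h + ((X *v h) \<bullet> h) / 2 \<le> u (x + h)"
    using touch by blast
  have "\<forall>\<^sub>F y in nhds x. y \<in> Om \<inter> ball x r"
    using Om r(1) by (intro eventually_nhds_in_open) auto
  then have "\<forall>\<^sub>F y in nhds x. \<phi> y \<le> u y"
  proof eventually_elim
    case (elim y)
    then show ?case using r(2)[of "y - x"] closure_subset[of Om] by (auto simp: \<phi>_def dist_norm norm_minus_commute)
  qed
  moreover have "C2_near \<phi> x" "hessian \<phi> x = X"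
    unfolding \<phi>_def using C2_near_quadratic[OF X] hessian_quadratic[OF X] by auto
  moreover have "\<phi> x = u x" by (simp add: \<phi>_def)
  ultimately show ?thesis using u Om(2) unfolding viscosity_supersolution_def by metis
qed

section \<open>The comparison principle\<close>

lemma matrix_minus_scalar_mult:
  fixes X :: "real^'n^'n"
  shows "(X - mat \<theta>) *v h = X *v h - \<theta> *\<^sub>R h"
proof -
  have "mat \<theta> *v h = \<theta> *\<^sub>R h"
    by (simp add: mat_def matrix_vector_mult_def vec_eq_iff if_distrib[of "\<lambda>a. a * _"] cong: if_cong)
  then show ?thesis by (simp add: matrix_vector_mult_diff_rdistrib)
qed

lemma transpose_minus_scalar:
  fixes X :: "real^'n^'n"
  assumes "transpose X = X"
  shows "transpose (X - mat \<theta>) = X - mat \<theta>"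
proof -
  have "X $ i $ j = X $ j $ i" for i j using assms by (metis transpose_def vec_lambda_beta)
  then show ?thesis by (auto simp: transpose_def vec_eq_iff mat_def)
qed

lemma eigval_minus_scalar_le:
  fixes X :: "real^'n^'n"
  assumes X: "transpose X = X" and i: "i \<in> {1..CARD('n)}"
  shows "eigval i (X - mat \<theta>) \<le> eigval i X - \<theta>"
proof -
  have "1 * (((X - mat \<theta>) *v \<xi>) \<bullet> \<xi>) \<le> 1 * ((X *v \<xi>) \<bullet> \<xi>) + (- \<theta>) * (norm \<xi>)\<^sup>2" for \<xi>
    by (simp add: matrix_minus_scalar_mult inner_diff_left power2_norm_eq_inner)
  from eigval_le_eigval[OF transpose_minus_scalar[OF X] X _ _ this i] show ?thesis by simp
qed

text \<open>Testing the block inequality with the pair \<open>(s \<xi>, t \<xi>)\<close> compares each eigenvalue separately,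
  so the weights need not be monotone in the index.\<close>

lemma weighted_eigval_sum_le:
  fixes X Z :: "real^'n^'n" and s t :: "nat \<Rightarrow> real"
  assumes X: "transpose X = X" and Z: "transpose Z = Z"
    and block: "\<And>h k. (X *v h) \<bullet> h + (Z *v k) \<bullet> k \<le> \<alpha> * (norm (h - k))\<^sup>2 + \<eta> * ((norm h)\<^sup>2 + (norm k)\<^sup>2)"
  shows "(\<Sum>i=1..CARD('n). (s i)\<^sup>2 * eigval i X) \<le> (\<Sum>i=1..CARD('n). (t i)\<^sup>2 * eigval i (- Z))
    + (\<Sum>i=1..CARD('n). \<alpha> * (s i - t i)\<^sup>2 + \<eta> * ((s i)\<^sup>2 + (t i)\<^sup>2))"
  unfolding sum.distrib[symmetric]
proof (rule sum_mono)
  fix i assume i: "i \<in> {1..CARD('n)}"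
  have Z': "transpose (- Z) = - Z" using Z by (simp add: transpose_def vec_eq_iff)
  have "(s i)\<^sup>2 * ((X *v \<xi>) \<bullet> \<xi>) \<le> (t i)\<^sup>2 * ((- Z *v \<xi>) \<bullet> \<xi>) + (\<alpha> * (s i - t i)\<^sup>2 + \<eta> * ((s i)\<^sup>2 + (t i)\<^sup>2)) * (norm \<xi>)\<^sup>2" for \<xi>
  proof -
    have mZ: "(- Z) *v \<xi> = - (Z *v \<xi>)"
      by (simp add: matrix_vector_mult_def vec_eq_iff sum_negf)
    show ?thesis
      using block[of "s i *\<^sub>R \<xi>" "t i *\<^sub>R \<xi>"] unfolding mZ
      by (simp add: matrix_vector_mult_scaleR power_mult_distrib power2_eq_square algebra_simps
          flip: scaleR_diff_left)
  qed
  from eigval_le_eigval[OF X Z' _ _ this i]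
  show "(s i)\<^sup>2 * eigval i X \<le> (t i)\<^sup>2 * eigval i (- Z) + (\<alpha> * (s i - t i)\<^sup>2 + \<eta> * ((s i)\<^sup>2 + (t i)\<^sup>2))"
    by simp
qed

theorem proposition2p5:
  fixes \<Omega> :: "(real^'n) set"
    and a :: "nat \<Rightarrow> real^'n \<Rightarrow> real"
    and f :: "real^'n \<Rightarrow> real"
  assumes "open \<Omega>" and "bounded \<Omega>"
    and "\<And>i. i \<in> {1..CARD('n)} \<Longrightarrow> continuous_on \<Omega> (a i)"
    and "\<And>i x. i \<in> {1..CARD('n)} \<Longrightarrow> x \<in> \<Omega> \<Longrightarrow> 0 \<le> a i x"
    and "\<And>x. x \<in> \<Omega> \<Longrightarrow> \<exists>i\<in>{1..CARD('n)}. a i x \<noteq> 0"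
    and "continuous_on \<Omega> f"
    and "\<And>i. i \<in> {1..CARD('n)} \<Longrightarrow> locally_lipschitz_on \<Omega> (\<lambda>x. sqrt (ahat a i x))"
  shows "comparison_principle (\<lambda>X x. (\<Sum>i=1..CARD('n). a i x * eigval i X) - f x) \<Omega>"
  unfolding comparison_principle_def
proof (intro allI impI ballI)
  let ?I = "{1..CARD('n)}"
  let ?F = "\<lambda>(X::real^'n^'n) x. (\<Sum>i\<in>?I. a i x * eigval i X) - f x"
  fix v u :: "real^'n \<Rightarrow> real" and x0
  assume v: "viscosity_subsolution ?F \<Omega> v" and u: "viscosity_supersolution ?F \<Omega> u"
    and bdry: "\<forall>x\<in>frontier \<Omega>. v x \<le> u x" and x0: "x0 \<in> \<Omega>"
  show "v x0 \<le> u x0"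
  proof (rule ccontr)
    assume "\<not> v x0 \<le> u x0"
    then have pos: "v x0 - u x0 > 0" by simp
    let ?K = "closure \<Omega>"
    have K: "compact ?K" using assms(2) by (simp add: compact_closure)
    have "bounded ?K" using assms(2) by (rule bounded_closure)
    then obtain R where R: "\<And>x. x \<in> ?K \<Longrightarrow> norm x \<le> R" by (auto simp: bounded_iff)
    have x0K: "x0 \<in> ?K" using x0 closure_subset by blast
    \<comment> \<open>At boundary points the perturbed difference will be at most
      \<open>\<theta> / 2 * R^2\<close>, strictly below its value at \<open>x0\<close>, which is at
      least \<open>\<theta> * (R^2 + 1)\<close>. The summand 1 also covers
      \<open>R = 0\<close>.\<close>
    define \<theta> where "\<theta> = (v x0 - u x0) / (R\<^sup>2 + 1)"
    have R1: "R\<^sup>2 + 1 > 0" by (simp add: add_nonneg_pos)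
    have \<theta>: "\<theta> > 0" "\<theta> * (R\<^sup>2 + 1) = v x0 - u x0" using pos R1 by (simp_all add: \<theta>_def)
    define vt where "vt x = v x + \<theta> / 2 * (norm x)\<^sup>2" for x
    define w where "w x = - u x" for x
    have vK: "usc_on ?K v" and uK: "lsc_on ?K u"
      using v u by (simp_all add: viscosity_subsolution_def viscosity_supersolution_def)
    have "usc_on ?K (\<lambda>x. \<theta> / 2 * (norm x)\<^sup>2)"
      by (intro usc_on_continuous continuous_intros)
    from usc_on_add[OF vK this] usc_on_uminus[OF uK] have usc: "usc_on ?K vt" "usc_on ?K w"
      by (simp_all add: vt_def[abs_def] w_def[abs_def])
    have Kne: "?K \<noteq> {}" using x0 by auto
    obtain m where m: "m \<in> ?K" "\<And>x. x \<in> ?K \<Longrightarrow> vt x + w x \<le> vt m + w m"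
      by (rule usc_on_attains_max[OF K Kne usc_on_add[OF usc]]) blast
    define S where "S = vt m + w m"
    have interior: "x \<in> \<Omega>" if "x \<in> ?K" "S \<le> vt x + w x" for x
    proof (rule ccontr)
      assume "x \<notin> \<Omega>"
      then have fr: "x \<in> frontier \<Omega>" using that(1) assms(1) by (simp add: frontier_def interior_open)
      have "(norm x)\<^sup>2 \<le> R\<^sup>2" using R[OF that(1)] by (intro power_mono) auto
      then have "\<theta> / 2 * (norm x)\<^sup>2 \<le> \<theta> / 2 * R\<^sup>2" using \<theta>(1) by (intro mult_left_mono) auto
      moreover have "0 \<le> \<theta> * R\<^sup>2" "0 \<le> \<theta> / 2 * (norm x0)\<^sup>2" using \<theta>(1) by simp_all
      moreover have "vt x0 + w x0 \<le> S" unfolding S_def by (rule m(2)[OF x0K])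
      moreover have "v x \<le> u x" using bdry fr by blast
      ultimately show False
        using that(2) \<theta> unfolding vt_def w_def distrib_left by linarith
    qed
    \<comment> \<open>Dividing by \<open>s\<close> gives weights whose square roots are the
      \<open>b i\<close>. The squares of the \<open>b i\<close> sum to 1, so the perturbation by
      \<open>\<theta>\<close> has the same effect at all points.\<close>
    define s where "s x = (\<Sum>i\<in>?I. \<bar>a i x\<bar>)" for x
    define g where "g x = f x / s x" for x
    define b where "b i x = sqrt (ahat a i x)" for i x
    have s_pos: "s x > 0" if x: "x \<in> \<Omega>" for x
    proof -
      obtain i where "i \<in> ?I" "a i x \<noteq> 0" using assms(5)[OF x] by blast
      then show ?thesis unfolding s_def by (intro sum_pos2[of _ i]) auto
    qed
    have b_sq: "(b i x)\<^sup>2 = a i x / s x" if "x \<in> \<Omega>" "i \<in> ?I" for i x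
      using assms(4)[OF that(2,1)] s_pos[OF that(1)] by (simp add: b_def ahat_def s_def)
    have b_sum: "(\<Sum>i\<in>?I. (b i x)\<^sup>2) = 1" if "x \<in> \<Omega>" for x
    proof -
      have "(\<Sum>i\<in>?I. (b i x)\<^sup>2) = (\<Sum>i\<in>?I. \<bar>a i x\<bar>) / s x"
        using assms(4) that by (simp add: b_sq sum_divide_distrib)
      then show ?thesis using s_pos[OF that] by (simp add: s_def)
    qed
    have normalize: "(\<Sum>i\<in>?I. a i x * c i) = s x * (\<Sum>i\<in>?I. (b i x)\<^sup>2 * c i)" if "x \<in> \<Omega>" for x c
      using s_pos[OF that] that by (simp add: b_sq sum_distrib_left)
    have f_eq: "f x = s x * g x" if "x \<in> \<Omega>" for x
      using s_pos[OF that] by (simp add: g_def)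
    have g_cont: "continuous_on \<Omega> g"
      unfolding g_def s_def using assms(3,6) s_pos[unfolded s_def]
      by (intro continuous_intros) (auto simp: less_imp_neq[symmetric])
    \<comment> \<open>The tolerance of the theorem on sums is taken to be
      \<open>1 / \<alpha>\<close>; the weights at \<open>x\<close> and \<open>y\<close> each sum to
      1, whence \<open>2 / \<alpha>\<close>. The membership conditions remain premises because only
      the limit shows that the points are interior.\<close>
    have step: "\<exists>x y. x \<in> ?K \<and> y \<in> ?K \<and> S - 1 / \<alpha> + \<alpha> / 6 * (norm (x - y))\<^sup>2 \<le> vt x + w y \<and>
      (x \<in> \<Omega> \<longrightarrow> y \<in> \<Omega> \<longrightarrow> g x + \<theta> \<le> g y + (\<alpha> * (\<Sum>i\<in>?I. (b i x - b i y)\<^sup>2) + 2 / \<alpha>))" if \<alpha>: "\<alpha> > 0" for \<alpha>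
    proof -
      have "1 / \<alpha> > 0" using \<alpha> by simp
      then obtain x y p q and X Z :: "real^'n^'n" where xy: "x \<in> ?K" "y \<in> ?K"
        and le: "vt m + w m - 1 / \<alpha> + \<alpha> / 6 * (norm (x - y))\<^sup>2 \<le> vt x + w y"
        and X: "transpose X = X" and Z: "transpose Z = Z"
        and block: "\<And>h k. (X *v h) \<bullet> h + (Z *v k) \<bullet> k \<le> \<alpha> * (norm (h - k))\<^sup>2 + 1 / \<alpha> * ((norm h)\<^sup>2 + (norm k)\<^sup>2)"
        and touchv: "\<exists>r>0. \<forall>h. norm h < r \<longrightarrow> x + h \<in> ?K \<longrightarrow> vt (x + h) \<le> vt x + p \<bullet> h + ((X *v h) \<bullet> h) / 2"
        and touchw: "\<exists>r>0. \<forall>h. norm h < r \<longrightarrow> y + h \<in> ?K \<longrightarrow> w (y + h) \<le> w y + q \<bullet> h + ((Z *v h) \<bullet> h) / 2"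
        using theorem_on_sums_usc[OF K m(1) usc \<alpha>] by metis
      have "g x + \<theta> \<le> g y + (\<alpha> * (\<Sum>i\<in>?I. (b i x - b i y)\<^sup>2) + 2 / \<alpha>)" if x: "x \<in> \<Omega>" and y: "y \<in> \<Omega>"
      proof -
        \<comment> \<open>Subtracting \<open>\<theta> / 2 * (norm x)^2\<close> from the paraboloid
          touching \<open>vt\<close> gives one touching \<open>v\<close>, with slope lowered by
          \<open>\<theta> *\<^sub>R x\<close> and Hessian by \<open>mat \<theta>\<close>.\<close>
        have "0 \<le> ?F (X - mat \<theta>) x"
        proof (rule viscosity_subsolution_touching[OF v assms(1) x, where p = "p - \<theta> *\<^sub>R x"])
          show "transpose (X - mat \<theta>) = X - mat \<theta>"
            by (rule transpose_minus_scalar[OF X])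
          have *: "v (x + h) \<le> v x + (p - \<theta> *\<^sub>R x) \<bullet> h + (((X - mat \<theta>) *v h) \<bullet> h) / 2
              \<longleftrightarrow> vt (x + h) \<le> vt x + p \<bullet> h + ((X *v h) \<bullet> h) / 2" for h
          proof -
            have "v (x + h) = vt (x + h) - \<theta> / 2 * (norm x)\<^sup>2 - \<theta> * (x \<bullet> h) - \<theta> / 2 * (h \<bullet> h)"
              by (simp add: vt_def power2_norm_eq_inner inner_simps inner_commute algebra_simps)
            moreover have "(p - \<theta> *\<^sub>R x) \<bullet> h + (((X - mat \<theta>) *v h) \<bullet> h) / 2
                = p \<bullet> h - \<theta> * (x \<bullet> h) + ((X *v h) \<bullet> h) / 2 - \<theta> / 2 * (h \<bullet> h)"
              by (simp add: matrix_minus_scalar_mult inner_diff_left diff_divide_distrib)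
            moreover have "vt x = v x + \<theta> / 2 * (norm x)\<^sup>2" by (simp add: vt_def)
            ultimately show ?thesis by linarith
          qed
          show "\<exists>r>0. \<forall>h. norm h < r \<longrightarrow> x + h \<in> ?K \<longrightarrow>
              v (x + h) \<le> v x + (p - \<theta> *\<^sub>R x) \<bullet> h + (((X - mat \<theta>) *v h) \<bullet> h) / 2"
            unfolding * by (rule touchv)
        qed
        also have "\<dots> \<le> (\<Sum>i\<in>?I. a i x * (eigval i X - \<theta>)) - f x"
          using assms(4)[OF _ x] eigval_minus_scalar_le[OF X]
          by (intro diff_right_mono sum_mono mult_left_mono) auto
        also have "\<dots> = s x * ((\<Sum>i\<in>?I. (b i x)\<^sup>2 * eigval i X) - \<theta> - g x)"
        proof -
          have "(\<Sum>i\<in>?I. (b i x)\<^sup>2 * (eigval i X - \<theta>)) = (\<Sum>i\<in>?I. (b i x)\<^sup>2 * eigval i X) - \<theta>"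
            using b_sum[OF x] by (simp add: right_diff_distrib sum_subtractf flip: sum_distrib_right)
          then show ?thesis unfolding normalize[OF x] f_eq[OF x] by (simp only: right_diff_distrib)
        qed
        finally have 1: "g x + \<theta> \<le> (\<Sum>i\<in>?I. (b i x)\<^sup>2 * eigval i X)"
          using s_pos[OF x] by (simp add: zero_le_mult_iff)
        have "?F (- Z) y \<le> 0"
        proof (rule viscosity_supersolution_touching[OF u assms(1) y, where p = "- q"])
          show "transpose (- Z) = - Z" using Z by (simp add: transpose_def vec_eq_iff)
          have "(- Z) *v h = - (Z *v h)" for h
            by (simp add: matrix_vector_mult_def vec_eq_iff sum_negf)
          then have *: "(u y + - q \<bullet> h + ((- Z *v h) \<bullet> h) / 2 \<le> u (y + h)) \<longleftrightarrow> (w (y + h) \<le> w y + q \<bullet> h + ((Z *v h) \<bullet> h) / 2)" for h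
            by (auto simp: w_def)
          show "\<exists>r>0. \<forall>h. norm h < r \<longrightarrow> y + h \<in> ?K \<longrightarrow> u y + - q \<bullet> h + ((- Z *v h) \<bullet> h) / 2 \<le> u (y + h)"
            unfolding * by (rule touchw)
        qed
        then have "s y * ((\<Sum>i\<in>?I. (b i y)\<^sup>2 * eigval i (- Z)) - g y) \<le> 0"
          unfolding normalize[OF y] f_eq[OF y] by (simp only: right_diff_distrib)
        then have 2: "(\<Sum>i\<in>?I. (b i y)\<^sup>2 * eigval i (- Z)) \<le> g y"
          using s_pos[OF y] by (simp add: mult_le_0_iff)
        have "(\<Sum>i\<in>?I. \<alpha> * (b i x - b i y)\<^sup>2 + 1 / \<alpha> * ((b i x)\<^sup>2 + (b i y)\<^sup>2))
          = \<alpha> * (\<Sum>i\<in>?I. (b i x - b i y)\<^sup>2) + 1 / \<alpha> * ((\<Sum>i\<in>?I. (b i x)\<^sup>2) + (\<Sum>i\<in>?I. (b i y)\<^sup>2))"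
          unfolding sum.distrib sum_distrib_left[symmetric] by (rule refl)
        then show ?thesis
          using 1 2 weighted_eigval_sum_le[OF X Z block, of "\<lambda>i. b i x" "\<lambda>i. b i y"] b_sum[OF x] b_sum[OF y]
          by simp
      qed
      with xy le show ?thesis unfolding S_def by blast
    qed
    have "\<forall>n. \<exists>z. fst z \<in> ?K \<and> snd z \<in> ?K \<and>
      S - 1 / real (Suc n) + real (Suc n) / 6 * (norm (fst z - snd z))\<^sup>2 \<le> vt (fst z) + w (snd z) \<and>
      (fst z \<in> \<Omega> \<longrightarrow> snd z \<in> \<Omega> \<longrightarrow> g (fst z) + \<theta> \<le> g (snd z) + (real (Suc n) * (\<Sum>i\<in>?I. (b i (fst z) - b i (snd z))\<^sup>2) + 2 / real (Suc n)))"
      unfolding split_paired_Ex fst_conv snd_conv by (intro allI step) simp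
    from choice[OF this] obtain z where z: "\<And>n. fst (z n) \<in> ?K" "\<And>n. snd (z n) \<in> ?K"
      "\<And>n. S - 1 / real (Suc n) + real (Suc n) / 6 * (norm (fst (z n) - snd (z n)))\<^sup>2 \<le> vt (fst (z n)) + w (snd (z n))"
      "\<And>n. fst (z n) \<in> \<Omega> \<Longrightarrow> snd (z n) \<in> \<Omega> \<Longrightarrow> g (fst (z n)) + \<theta> \<le> g (snd (z n)) + (real (Suc n) * (\<Sum>i\<in>?I. (b i (fst (z n)) - b i (snd (z n)))\<^sup>2) + 2 / real (Suc n))"
      by blast
    have "z n \<in> ?K \<times> ?K" for n using z(1,2)[of n] by (simp add: mem_Times_iff)
    then obtain l \<sigma> where l: "l \<in> ?K \<times> ?K" and \<sigma>: "strict_mono (\<sigma> :: nat \<Rightarrow> nat)" and lim: "(z \<circ> \<sigma>) \<longlonglongrightarrow> l"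
      using compact_Times[OF K K] unfolding compact_def by metis
    define x where "x n = fst (z (\<sigma> n))" for n
    define y where "y n = snd (z (\<sigma> n))" for n
    define \<alpha> where "\<alpha> n = real (Suc (\<sigma> n))" for n
    define d where "d n = \<alpha> n * (norm (x n - y n))\<^sup>2" for n
    define xl where "xl = fst l"
    define yl where "yl = snd l"
    have xK: "x n \<in> ?K" and yK: "y n \<in> ?K" for n using z(1,2) by (auto simp: x_def y_def)
    have xlK: "xl \<in> ?K" and ylK: "yl \<in> ?K" using l by (auto simp: xl_def yl_def)
    have x_lim: "x \<longlonglongrightarrow> xl" and y_lim: "y \<longlonglongrightarrow> yl"
      using tendsto_fst[OF lim] tendsto_snd[OF lim] by (simp_all add: x_def[abs_def] y_def[abs_def] xl_def yl_def o_def)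
    have \<alpha>_pos: "\<alpha> n > 0" for n by (simp add: \<alpha>_def)
    have d_nonneg: "0 \<le> d n" for n using \<alpha>_pos[of n] by (simp add: d_def)
    have \<alpha>_lim: "(\<lambda>n. 1 / \<alpha> n) \<longlonglongrightarrow> 0"
      using LIMSEQ_subseq_LIMSEQ[OF LIMSEQ_inverse_real_of_nat \<sigma>] by (simp add: \<alpha>_def o_def inverse_eq_divide)
    have main: "S - 1 / \<alpha> n + d n / 6 \<le> vt (x n) + w (y n)" for n
      using z(3)[of "\<sigma> n"] by (simp add: x_def y_def \<alpha>_def d_def)
    \<comment> \<open>The bounds on \<open>vt\<close> and \<open>w\<close> keep the penalty
      \<open>d n\<close> bounded while its factor \<open>\<alpha> n\<close> tends to
      infinity.\<close>
    have "xl = yl"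
    proof -
      obtain mv where mv: "\<And>y. y \<in> ?K \<Longrightarrow> vt y \<le> vt mv" by (rule usc_on_attains_max[OF K Kne usc(1)]) blast
      obtain mw where mw: "\<And>y. y \<in> ?K \<Longrightarrow> w y \<le> w mw" by (rule usc_on_attains_max[OF K Kne usc(2)]) blast
      define C where "C = 6 * (vt mv + w mw - S + 1)"
      have "(norm (x n - y n))\<^sup>2 \<le> C * (1 / \<alpha> n)" for n
      proof -
        have "1 / \<alpha> n \<le> 1" by (simp add: \<alpha>_def)
        then have "d n \<le> C" using main[of n] mv[OF xK[of n]] mw[OF yK[of n]] by (simp add: C_def)
        then show ?thesis using \<alpha>_pos[of n] by (simp add: d_def field_simps)
      qed
      moreover have "(\<lambda>n. C * (1 / \<alpha> n)) \<longlonglongrightarrow> C * 0" by (intro tendsto_intros \<alpha>_lim)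
      moreover have "(\<lambda>n. (norm (x n - y n))\<^sup>2) \<longlonglongrightarrow> (norm (xl - yl))\<^sup>2" by (intro tendsto_intros x_lim y_lim)
      ultimately have "(norm (xl - yl))\<^sup>2 \<le> C * 0"
        by (intro LIMSEQ_le[of "\<lambda>n. (norm (x n - y n))\<^sup>2" _ "\<lambda>n. C * (1 / \<alpha> n)"]) auto
      then show ?thesis by simp
    qed
    \<comment> \<open>Only upper bounds are available, one for \<open>vt\<close> along
      \<open>x n\<close> and one for \<open>w\<close> along \<open>y n\<close>; they suffice since
      \<open>main\<close> bounds the sum from below.\<close>
    have near: "\<forall>\<^sub>F n in sequentially. S + d n / 6 \<le> vt xl + w xl + \<epsilon>" if \<epsilon>: "\<epsilon> > 0" for \<epsilon>
    proof -
      have "\<forall>\<^sub>F n in sequentially. vt (x n) < vt xl + \<epsilon> / 3"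
        using \<epsilon> by (intro usc_on_eventually_less[OF usc(1) xlK _ xK x_lim]) simp
      moreover have "\<forall>\<^sub>F n in sequentially. w (y n) < w xl + \<epsilon> / 3"
        using \<epsilon> \<open>xl = yl\<close> ylK y_lim by (intro usc_on_eventually_less[OF usc(2) _ _ yK]) auto
      moreover have "\<forall>\<^sub>F n in sequentially. 1 / \<alpha> n < \<epsilon> / 3"
        using \<epsilon> by (intro order_tendstoD(2)[OF \<alpha>_lim]) simp
      ultimately show ?thesis
      proof eventually_elim
        case (elim n)
        then show ?case using main[of n] by linarith
      qed
    qed
    have S_le: "S \<le> vt xl + w xl"
    proof (rule field_le_epsilon)
      fix \<epsilon> :: real assume "\<epsilon> > 0"
      from eventually_happens[OF near[OF this]] obtain n where "S + d n / 6 \<le> vt xl + w xl + \<epsilon>" by auto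
      then show "S \<le> vt xl + w xl + \<epsilon>" using d_nonneg[of n] by linarith
    qed
    then have xl: "xl \<in> \<Omega>" by (rule interior[OF xlK])
    have "vt xl + w xl \<le> S" unfolding S_def by (rule m(2)[OF xlK])
    \<comment> \<open>\<open>S\<close> is the maximum of \<open>vt + w\<close>, so the value at the
      limit point leaves no room for the penalty.\<close>
    have d_lim: "d \<longlonglongrightarrow> 0"
    proof (rule tendstoI)
      fix \<epsilon> :: real assume \<epsilon>: "\<epsilon> > 0"
      have "\<forall>\<^sub>F n in sequentially. S + d n / 6 \<le> vt xl + w xl + \<epsilon> / 12" using \<epsilon> by (intro near) simp
      then show "\<forall>\<^sub>F n in sequentially. dist (d n) 0 < \<epsilon>"
      proof eventually_elim
        case (elim n)
        then have "d n < \<epsilon>" using \<open>vt xl + w xl \<le> S\<close> \<epsilon> by linarith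
        then show ?case using d_nonneg[of n] by (simp add: dist_real_def)
      qed
    qed
    \<comment> \<open>The limit \<open>xl\<close> is interior, so both sequences eventually lie in
      one ball on which \<open>b i\<close> is Lipschitz.\<close>
    have "\<exists>L. \<forall>\<^sub>F n in sequentially. (b i (x n) - b i (y n))\<^sup>2 \<le> L\<^sup>2 * (norm (x n - y n))\<^sup>2" if i: "i \<in> ?I" for i
    proof -
      obtain r L where r: "r > 0" and L: "L-lipschitz_on (ball xl r \<inter> \<Omega>) (b i)"
        using assms(7)[OF i] xl unfolding locally_lipschitz_on_def b_def by blast
      have nb: "open (ball xl r \<inter> \<Omega>)" "xl \<in> ball xl r \<inter> \<Omega>" using assms(1) r xl by auto
      have "\<forall>\<^sub>F n in sequentially. x n \<in> ball xl r \<inter> \<Omega>" by (rule topological_tendstoD[OF x_lim nb])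
      moreover have "\<forall>\<^sub>F n in sequentially. y n \<in> ball xl r \<inter> \<Omega>"
        using topological_tendstoD[OF y_lim nb(1)] nb(2) \<open>xl = yl\<close> by simp
      ultimately have "\<forall>\<^sub>F n in sequentially. (b i (x n) - b i (y n))\<^sup>2 \<le> L\<^sup>2 * (norm (x n - y n))\<^sup>2"
      proof eventually_elim
        case (elim n)
        have "\<bar>b i (x n) - b i (y n)\<bar> \<le> L * norm (x n - y n)"
          using lipschitz_onD[OF L elim] by (simp add: dist_norm)
        from power_mono[OF this, of 2] show ?case by (simp add: power_mult_distrib)
      qed
      then show ?thesis by blast
    qed
    then have "\<forall>i\<in>?I. \<exists>L. \<forall>\<^sub>F n in sequentially. (b i (x n) - b i (y n))\<^sup>2 \<le> L\<^sup>2 * (norm (x n - y n))\<^sup>2"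
      by (rule ballI)
    from bchoice[OF this] obtain L where
      L: "\<And>i. i \<in> ?I \<Longrightarrow> \<forall>\<^sub>F n in sequentially. (b i (x n) - b i (y n))\<^sup>2 \<le> (L i)\<^sup>2 * (norm (x n - y n))\<^sup>2"
      by blast
    have "\<forall>\<^sub>F n in sequentially. \<forall>i\<in>?I. (b i (x n) - b i (y n))\<^sup>2 \<le> (L i)\<^sup>2 * (norm (x n - y n))\<^sup>2"
      using L by (intro eventually_ball_finite) auto
    moreover have "\<forall>\<^sub>F n in sequentially. x n \<in> \<Omega>" by (rule topological_tendstoD[OF x_lim assms(1) xl])
    moreover have "\<forall>\<^sub>F n in sequentially. y n \<in> \<Omega>" using topological_tendstoD[OF y_lim assms(1)] xl \<open>xl = yl\<close> by simp
    \<comment> \<open>The factor \<open>\<alpha> n\<close> meets squared differences of the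
      \<open>b i\<close>, so the error is a multiple of \<open>d n\<close>. In the limit only
      \<open>\<theta> \<le> 0\<close> would remain.\<close>
    ultimately have "\<forall>\<^sub>F n in sequentially. g (x n) + \<theta> \<le> g (y n) + ((\<Sum>i\<in>?I. (L i)\<^sup>2) * d n + 2 * (1 / \<alpha> n))"
    proof eventually_elim
      case (elim n)
      have "(\<Sum>i\<in>?I. (b i (x n) - b i (y n))\<^sup>2) \<le> (\<Sum>i\<in>?I. (L i)\<^sup>2) * (norm (x n - y n))\<^sup>2"
        unfolding sum_distrib_right using elim(1) by (intro sum_mono) auto
      then have "\<alpha> n * (\<Sum>i\<in>?I. (b i (x n) - b i (y n))\<^sup>2) \<le> \<alpha> n * ((\<Sum>i\<in>?I. (L i)\<^sup>2) * (norm (x n - y n))\<^sup>2)"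
        using \<alpha>_pos[of n] by (intro mult_left_mono) auto
      also have "\<dots> = (\<Sum>i\<in>?I. (L i)\<^sup>2) * d n" by (simp add: d_def)
      finally show ?case
        using z(4)[of "\<sigma> n"] elim(2,3) unfolding x_def y_def \<alpha>_def by simp
    qed
    moreover have "(\<lambda>n. g (x n) + \<theta>) \<longlonglongrightarrow> g xl + \<theta>"
      using continuous_on_tendsto_compose[OF g_cont x_lim xl topological_tendstoD[OF x_lim assms(1) xl]]
      by (intro tendsto_intros)
    moreover have "(\<lambda>n. g (y n) + ((\<Sum>i\<in>?I. (L i)\<^sup>2) * d n + 2 * (1 / \<alpha> n))) \<longlonglongrightarrow> g xl + ((\<Sum>i\<in>?I. (L i)\<^sup>2) * 0 + 2 * 0)"
      using continuous_on_tendsto_compose[OF g_cont y_lim[folded \<open>xl = yl\<close>] xl topological_tendstoD[OF y_lim[folded \<open>xl = yl\<close>] assms(1) xl]]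
      by (intro tendsto_intros d_lim \<alpha>_lim)
    ultimately have "g xl + \<theta> \<le> g xl + ((\<Sum>i\<in>?I. (L i)\<^sup>2) * 0 + 2 * 0)"
      by (intro tendsto_le[OF sequentially_bot])
    then show False using \<theta>(1) by simp
  qed
qed

end
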